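(* A family $(K_t)_{t\in[0,1]}$ of full-dimensional convex bodies in $\mathbb{R}^n$ is weakly differentiable if and only if there exists a signed measure $\mu\in\mathsf{M}(\mathrm{bd}\,K_0)$ such that $$\left.\frac{d}{dt}\phi_f(t)\right|_{t=0}=\lim_{t\to0^+}\frac1t\left(\int_{K_t}f(x)\,dx-\int_{K_0}f(x)\,dx\right)=\int_{\mathrm{bd}\,K_0}f\,d\mu$$ for all continuous functions $f:\mathbb{R}^n\to\mathbb{R}$.
   Context: A convex body is a non-empty compact convex subset of $\mathbb{R}^n$. For a family $(K_t)_{t\in[0,1]}$ of full-dimensional convex bodies and continuous $f:\mathbb{R}^n\to\mathbb{R}$ put $\phi_f(t)=\int_{K_t}f(x)\,dx$, $t\in[0,1]$. The family is weakly differentiable if $\phi_f$ is differentiable from the right at $t=0$ for every continuous $f:\mathbb{R}^n\to\mathbb{R}$. A signed measure is a finite signed Borel measure on $\mathbb{R}^n$; for a Borel set $X$, $\mathsf{M}(X)$ is the vector space of signed measures supported on $X$, i.e. with $\mu(B)=0$ for all Borel $B\subset\mathbb{R}^n\setminus X$. *)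

theory Defs
  imports "HOL-Analysis.Analysis"
begin

definition convex_body :: "'a::euclidean_space set \<Rightarrow> bool" where
  "convex_body C \<longleftrightarrow> C \<noteq> {} \<and> compact C \<and> convex C"

definition full_dimensional :: "'a::euclidean_space set \<Rightarrow> bool" where
  "full_dimensional C \<longleftrightarrow> aff_dim C = int DIM('a)"

definition body_integral :: "(real \<Rightarrow> 'a::euclidean_space set) \<Rightarrow> ('a \<Rightarrow> real) \<Rightarrow> real \<Rightarrow> real" where
  "body_integral K f t = (LINT x:K t|lborel. f x)"

definition weakly_differentiable :: "(real \<Rightarrow> 'a::euclidean_space set) \<Rightarrow> bool" where
  "weakly_differentiable K \<longleftrightarrow>
     (\<forall>f. continuous_on UNIV f \<longrightarrow> body_integral K f differentiable (at_right 0))"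

(* A finite signed Borel measure is a real-valued set function of which only the
   values on Borel sets are relevant. *)
definition signed_borel_measure :: "('a::topological_space set \<Rightarrow> real) \<Rightarrow> bool" where
  "signed_borel_measure \<mu> \<longleftrightarrow>
     \<mu> {} = 0 \<and>
     (\<forall>A :: nat \<Rightarrow> 'a set. range A \<subseteq> sets borel \<longrightarrow> disjoint_family A \<longrightarrow>
        (\<lambda>i. \<mu> (A i)) sums \<mu> (\<Union>i. A i))"

definition signed_measures_on :: "'a::topological_space set \<Rightarrow> ('a set \<Rightarrow> real) set" where
  "signed_measures_on X =
     {\<mu>. signed_borel_measure \<mu> \<and> (\<forall>B \<in> sets borel. B \<subseteq> - X \<longrightarrow> \<mu> B = 0)}"

(* Jordan decomposition: the positive variation of A is the supremum of \<mu> B over the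
   Borel sets B contained in A.  As ennreal truncates negative reals to 0 and
   B = {} is admitted, the supremum may be taken in ennreal. *)
definition pos_variation :: "('a::topological_space set \<Rightarrow> real) \<Rightarrow> 'a measure" where
  "pos_variation \<mu> = measure_of UNIV (sets borel)
     (\<lambda>A. SUP B \<in> {B \<in> sets borel. B \<subseteq> A}. ennreal (\<mu> B))"

definition neg_variation :: "('a::topological_space set \<Rightarrow> real) \<Rightarrow> 'a measure" where
  "neg_variation \<mu> = pos_variation (\<lambda>A. - \<mu> A)"

definition signed_set_integral ::
    "('a::topological_space set \<Rightarrow> real) \<Rightarrow> 'a set \<Rightarrow> ('a \<Rightarrow> real) \<Rightarrow> real" where
  "signed_set_integral \<mu> X f =
     (LINT x:X|pos_variation \<mu>. f x) - (LINT x:X|neg_variation \<mu>. f x)"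

end

theory Submission
  imports Defs "HOL-Probability.Probability"
begin

text \<open>
  The derivative is a linear functional \<open>L\<close> on continuous functions, the limit of the functionals
  \<open>\<Lambda>\<^sub>k f = (1 / t\<^sub>k) * (\<integral>\<^bsub>K t\<^sub>k\<^esub> f - \<integral>\<^bsub>K 0\<^esub> f)\<close> for the sequence \<open>t\<^sub>k = 1 / (k + 1)\<close>. Such a functional is
  integration against a signed measure with density \<open>1 / t\<^sub>k\<close> on \<open>K t\<^sub>k - K 0\<close> and \<open>-1 / t\<^sub>k\<close> on
  \<open>K 0 - K t\<^sub>k\<close>. Because \<open>\<Lambda>\<^sub>k f\<close> is bounded in \<open>k\<close> for each \<open>f\<close>, the Banach-Steinhaus theorem bounds the
  total variations \<open>vol (K t\<^sub>k \<triangle> K 0) / t\<^sub>k\<close> (lemma \<open>volume_symm_diff_quotient_bounded\<close>).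

  Differentiability also makes the integrals over \<open>K t\<^sub>k\<close> converge to those over \<open>K 0\<close>, and for convex
  bodies this implies convergence in the Hausdorff metric: the symmetric difference ends up in every
  neighbourhood of the boundary of \<open>K 0\<close> (lemma \<open>eventually_symm_diff_near_frontier\<close>). In particular,
  from some index on, the signed measures live on a common bounded set, and \<open>L f = 0\<close> whenever \<open>f\<close> vanishes near the boundary.

  The positive and negative parts therefore have vaguely convergent subsequences
  (lemma \<open>vague_sequential_compactness\<close>) with limits \<open>P\<close> and \<open>Q\<close>, and \<open>L f = \<integral>f dP - \<integral>f dQ\<close>. This
  selection principle takes the place of the Riesz representation theorem; it is deduced from
  Helly's theorem on the real line by means of a space-filling curve. As \<open>P\<close> and \<open>Q\<close> agree off the
  boundary, \<open>P - Q\<close> is a signed measure on the boundary, and integration against it, defined by the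
  Jordan decomposition, gives back \<open>L\<close> (lemma \<open>signed_set_integral_diff\<close>). The converse implication is
  immediate, since a given derivative is a proof of differentiability.
\<close>

section \<open>A space-filling curve with a Borel right inverse\<close>

text \<open>A continuous function of period 2 that vanishes on the first third of [0, 1] and equals 1 on
  the last third: it reads off whether the leading ternary digit is 0 or 2.\<close>

definition bit_wave :: "real \<Rightarrow> real" where
  "bit_wave s = max 0 (min 1 (1/2 - cos (pi * s)))"

lemma bit_wave_bounds: "0 \<le> bit_wave s" "bit_wave s \<le> 1"
  by (auto simp: bit_wave_def)

lemma continuous_on_bit_wave [continuous_intros]:
  fixes f :: "'a::t2_space \<Rightarrow> real"
  shows "continuous_on A f \<Longrightarrow> continuous_on A (\<lambda>x. bit_wave (f x))"
  unfolding bit_wave_def by (intro continuous_intros)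

lemma bit_wave_eq:
  assumes "0 \<le> r" "r \<le> 1"
  shows "bit_wave (2 * of_int m + (2 * of_bool b + r) / 3) = of_bool b"
proof -
  have "pi * (2 * of_int m + x) = pi * x + 2 * pi * of_int m" for x :: real
    by (simp add: algebra_simps)
  then have per: "cos (pi * (2 * of_int m + x)) = cos (pi * x)" for x :: real
    by (simp add: cos_add cos_int_2pin sin_int_2pin)
  show ?thesis
  proof (cases b)
    case True
    have "pi * (2/3) \<le> pi * ((2 + r) / 3)" using assms by (intro mult_left_mono) auto
    moreover have "pi * ((2 + r) / 3) \<le> pi * 1" using assms by (intro mult_left_mono) auto
    ultimately have "cos (pi * ((2 + r) / 3)) \<le> cos (2 / 3 * pi)"
      by (intro cos_monotone_0_pi_le) (auto simp: algebra_simps)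
    then have "cos (pi * ((2 + r) / 3)) \<le> - 1/2" using cos_120 by (simp add: algebra_simps)
    with True show ?thesis unfolding bit_wave_def per by simp
  next
    case False
    have "pi * (r / 3) \<le> pi * (1 / 3)" using assms by (intro mult_left_mono) auto
    moreover have "0 \<le> pi * (r / 3)" using assms by auto
    ultimately have "cos (pi / 3) \<le> cos (pi * (r / 3))"
      by (intro cos_monotone_0_pi_le) (auto simp: algebra_simps)
    then have "cos (pi * (r / 3)) \<ge> 1/2" using cos_60 by (simp add: algebra_simps)
    with False show ?thesis unfolding bit_wave_def per by simp
  qed
qed

text \<open>A prescribed bit sequence is encoded by the point of the Cantor set with ternary digits
  \<open>2 * a k\<close>. Multiplication by \<open>3 ^ k\<close> shifts digit \<open>k\<close> to the front, up to an even integer,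
  which the period of the wave absorbs.\<close>

lemma ex_bit_wave_digits:
  fixes a :: "nat \<Rightarrow> bool"
  shows "\<exists>t\<in>{0..1}. \<forall>k. bit_wave (3 ^ k * t) = of_bool (a k)"
proof -
  define T where "T b = (\<Sum>i. 2 * of_bool (b i) / 3 ^ Suc i :: real)" for b :: "nat \<Rightarrow> bool"
  have geo: "(\<lambda>i. 2 / 3 ^ Suc i :: real) sums 1"
    using sums_mult[OF geometric_sums[of "1/3::real"], of "2/3"]
    by (simp add: power_one_over field_simps)
  have sm: "summable (\<lambda>i. 2 * of_bool (b i) / 3 ^ Suc i :: real)" for b :: "nat \<Rightarrow> bool"
    by (rule summable_comparison_test'[OF sums_summable[OF geo], of 0]) auto
  have T01: "0 \<le> T b" "T b \<le> 1" for b
  proof -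
    show "0 \<le> T b" unfolding T_def by (rule suminf_nonneg[OF sm]) auto
    have "T b \<le> (\<Sum>i. 2 / 3 ^ Suc i :: real)" unfolding T_def
      by (rule suminf_le[OF _ sm sums_summable[OF geo]]) auto
    then show "T b \<le> 1" using sums_unique[OF geo] by simp
  qed
  have shift: "T b = (2 * of_bool (b 0) + T (\<lambda>i. b (Suc i))) / 3" for b
  proof -
    have "T b = 2 * of_bool (b 0) / 3 + (\<Sum>i. 2 * of_bool (b (Suc i)) / 3 ^ Suc (Suc i))"
      using suminf_split_head[OF sm[of b]] unfolding T_def by simp
    also have "(\<Sum>i. 2 * of_bool (b (Suc i)) / 3 ^ Suc (Suc i) :: real)
        = (\<Sum>i. (2 * of_bool (b (Suc i)) / 3 ^ Suc i) / 3)"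
      by (intro suminf_cong) (simp add: field_simps)
    also have "\<dots> = T (\<lambda>i. b (Suc i)) / 3"
      unfolding T_def by (rule suminf_divide[OF sm])
    finally show ?thesis by (simp add: add_divide_distrib)
  qed
  have "\<exists>m::int. 3 ^ k * T a = 2 * of_int m + T (\<lambda>i. a (k + i))" for k
  proof (induction k)
    case 0
    show ?case by (intro exI[of _ 0]) simp
  next
    case (Suc k)
    then obtain m :: int where m: "3 ^ k * T a = 2 * of_int m + T (\<lambda>i. a (k + i))" by blast
    have "3 ^ Suc k * T a = 3 * (3 ^ k * T a)" by simp
    also have "\<dots> = 2 * of_int (3 * m + of_bool (a k)) + T (\<lambda>i. a (Suc k + i))"
      unfolding m using shift[of "\<lambda>i. a (k + i)"] by simp
    finally show ?case by blast
  qed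
  then have "bit_wave (3 ^ k * T a) = of_bool (a k)" for k
    using bit_wave_eq[OF T01] shift[of "\<lambda>i. a (k + i)"] by (metis add_0_right)
  then show ?thesis using T01 by (intro bexI[of _ "T a"]) auto
qed

lemma ex_binary_digits:
  fixes y :: real
  assumes "0 \<le> y" "y < 1"
  shows "\<exists>a :: nat \<Rightarrow> bool. (\<lambda>k. of_bool (a k) / 2 ^ Suc k) sums y"
proof -
  define a where "a k = odd \<lfloor>2 ^ Suc k * y\<rfloor>" for k
  have dbl: "\<lfloor>2 * x\<rfloor> = 2 * \<lfloor>x\<rfloor> + of_bool (odd \<lfloor>2 * x\<rfloor>)" for x :: real
  proof -
    have "\<lfloor>2 * x\<rfloor> = 2 * \<lfloor>x\<rfloor> \<or> \<lfloor>2 * x\<rfloor> = 2 * \<lfloor>x\<rfloor> + 1"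
    proof -
      have "2 * \<lfloor>x\<rfloor> \<le> \<lfloor>2 * x\<rfloor>" by (simp add: le_floor_iff)
      moreover have "\<lfloor>2 * x\<rfloor> < 2 * \<lfloor>x\<rfloor> + 2" unfolding floor_less_iff by simp linarith
      ultimately show ?thesis by linarith
    qed
    then show ?thesis by auto
  qed
  have part: "(\<Sum>k<m. of_bool (a k) / 2 ^ Suc k) = real_of_int \<lfloor>2 ^ m * y\<rfloor> / 2 ^ m" for m
  proof (induction m)
    case 0
    have "\<lfloor>y\<rfloor> = 0" using assms by (intro floor_unique) auto
    then show ?case by simp
  next
    case (Suc m)
    have "real_of_int \<lfloor>2 ^ Suc m * y\<rfloor> = 2 * of_int \<lfloor>2 ^ m * y\<rfloor> + of_bool (a m)"
      using arg_cong[OF dbl[of "2 ^ m * y"], of real_of_int] unfolding a_def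
      by (simp add: mult.assoc)
    then show ?case using Suc.IH by (simp add: field_simps)
  qed
  have "(\<lambda>m. (1/2::real) ^ m) \<longlonglongrightarrow> 0" by (rule LIMSEQ_realpow_zero) auto
  then have lim: "(\<lambda>m. y - (1/2) ^ m) \<longlonglongrightarrow> y" using tendsto_diff[OF tendsto_const] by fastforce
  have lower: "y - (1/2) ^ m \<le> real_of_int \<lfloor>2 ^ m * y\<rfloor> / 2 ^ m" for m
  proof -
    have "2 ^ m * y - 1 \<le> real_of_int \<lfloor>2 ^ m * y\<rfloor>" by linarith
    then have "(2 ^ m * y - 1) / 2 ^ m \<le> real_of_int \<lfloor>2 ^ m * y\<rfloor> / 2 ^ m" by (intro divide_right_mono) auto
    then show ?thesis by (simp add: diff_divide_distrib power_one_over)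
  qed
  have upper: "real_of_int \<lfloor>2 ^ m * y\<rfloor> / 2 ^ m \<le> y" for m
  proof -
    have "real_of_int \<lfloor>2 ^ m * y\<rfloor> / 2 ^ m \<le> (2 ^ m * y) / 2 ^ m"
      by (intro divide_right_mono of_int_floor_le) simp
    then show ?thesis by simp
  qed
  have "(\<lambda>m. real_of_int \<lfloor>2 ^ m * y\<rfloor> / 2 ^ m) \<longlonglongrightarrow> y"
    by (rule tendsto_sandwich[OF always_eventually always_eventually lim tendsto_const])
       (intro allI lower upper)+
  then show ?thesis unfolding sums_def part[symmetric] by blast
qed

text \<open>Schoenberg's space-filling curve: each coordinate is a uniformly convergent series that decodes
  its own arithmetic progression of ternary digits of the parameter into a binary expansion, so the
  coordinates can be prescribed independently.\<close>

lemma ex_unit_cube_filling_curve: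
  "\<exists>\<gamma> :: real \<Rightarrow> 'a::euclidean_space. continuous_on UNIV \<gamma> \<and> bounded (range \<gamma>) \<and>
     {x. \<forall>b\<in>Basis. 0 \<le> x \<bullet> b \<and> x \<bullet> b < 1} \<subseteq> \<gamma> ` {0..1}"
proof -
  define N where "N = DIM('a)"
  obtain j :: "'a \<Rightarrow> nat" where j: "bij_betw j Basis {0..<N}"
    using ex_bij_betw_finite_nat[OF finite_Basis] N_def by blast
  have jN: "j b < N" if "b \<in> Basis" for b using j that by (auto simp: bij_betw_def)
  have geo: "(\<lambda>k. 1 / 2 ^ Suc k :: real) sums 1"
    using power_half_series by (simp add: power_one_over)
  define g where "g i t = (\<Sum>k. bit_wave (3 ^ (k * N + i) * t) / 2 ^ Suc k)" for i t
  have sm: "summable (\<lambda>k. bit_wave (3 ^ (k * N + i) * t) / 2 ^ Suc k)" for i t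
    by (rule summable_comparison_test'[OF sums_summable[OF geo], of 0])
       (auto simp: bit_wave_bounds divide_right_mono)
  have g01: "0 \<le> g i t" "g i t \<le> 1" for i t
  proof -
    show "0 \<le> g i t" unfolding g_def by (rule suminf_nonneg[OF sm]) (auto simp: bit_wave_bounds)
    have "g i t \<le> (\<Sum>k. 1 / 2 ^ Suc k :: real)" unfolding g_def
      by (rule suminf_le[OF _ sm sums_summable[OF geo]]) (auto simp: bit_wave_bounds divide_right_mono)
    then show "g i t \<le> 1" using sums_unique[OF geo] by simp
  qed
  have gc: "continuous_on UNIV (g i)" for i
  proof -
    have "uniform_limit UNIV (\<lambda>n t. \<Sum>k<n. bit_wave (3 ^ (k * N + i) * t) / 2 ^ Suc k) (g i) sequentially"
      unfolding g_def
      by (rule Weierstrass_m_test[OF _ sums_summable[OF geo]])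
         (auto simp: bit_wave_bounds divide_right_mono)
    then show ?thesis
      by (rule uniform_limit_theorem[rotated])
         (auto intro!: always_eventually continuous_intros)
  qed
  define \<gamma> :: "real \<Rightarrow> 'a" where "\<gamma> t = (\<Sum>b\<in>Basis. g (j b) t *\<^sub>R b)" for t
  have coord: "\<gamma> t \<bullet> b = g (j b) t" if "b \<in> Basis" for t b
    using that unfolding \<gamma>_def by simp
  have "continuous_on UNIV \<gamma>" unfolding \<gamma>_def
    by (intro continuous_intros gc)
  moreover have "bounded (range \<gamma>)"
  proof (rule bounded_subset[OF bounded_cbox[of "0::'a" One]])
    show "range \<gamma> \<subseteq> cbox 0 One" using g01 by (auto simp: mem_box coord)
  qed
  moreover have "x \<in> \<gamma> ` {0..1}" if x: "\<forall>b\<in>Basis. 0 \<le> x \<bullet> b \<and> x \<bullet> b < 1" for x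
  proof -
    have "\<forall>b\<in>Basis. \<exists>a :: nat \<Rightarrow> bool. (\<lambda>k. of_bool (a k) / 2 ^ Suc k) sums (x \<bullet> b)"
      using x ex_binary_digits by blast
    then obtain a where a: "\<And>b. b \<in> Basis \<Longrightarrow> (\<lambda>k. of_bool (a b k) / 2 ^ Suc k) sums (x \<bullet> b)"
      by metis
    \<comment> \<open>Digit \<open>k\<close> of the coordinate numbered \<open>i\<close> is stored at position \<open>k * N + i\<close>.\<close>
    define c where "c n = a (inv_into Basis j (n mod N)) (n div N)" for n
    obtain t where t: "t \<in> {0..1}" "\<And>n. bit_wave (3 ^ n * t) = of_bool (c n)"
      using ex_bit_wave_digits[of c] by blast
    have "\<gamma> t \<bullet> b = x \<bullet> b" if b: "b \<in> Basis" for b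
    proof -
      have "c (k * N + j b) = a b k" for k
        using jN[OF b] j b unfolding c_def by (simp add: bij_betw_def inv_into_f_f)
      then have "g (j b) t = (\<Sum>k. of_bool (a b k) / 2 ^ Suc k)"
        unfolding g_def t(2) by simp
      then show ?thesis using coord[OF b] sums_unique[OF a[OF b]] by simp
    qed
    then have "x = \<gamma> t" by (intro euclidean_eqI[of x "\<gamma> t"]) auto
    then show ?thesis using t(1) by blast
  qed
  ultimately show ?thesis by (intro exI[of _ \<gamma>]) auto
qed

lemma ex_filling_curve:
  fixes C :: "'a::euclidean_space set"
  assumes "bounded C"
  shows "\<exists>\<gamma> :: real \<Rightarrow> 'a. continuous_on UNIV \<gamma> \<and> bounded (range \<gamma>) \<and> C \<subseteq> \<gamma> ` {0..1}"
proof -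
  obtain R where R: "R > 0" "\<And>x. x \<in> C \<Longrightarrow> norm x \<le> R"
    using assms bounded_pos by blast
  obtain \<gamma> :: "real \<Rightarrow> 'a" where \<gamma>: "continuous_on UNIV \<gamma>" "bounded (range \<gamma>)"
    "{x. \<forall>b\<in>Basis. 0 \<le> x \<bullet> b \<and> x \<bullet> b < 1} \<subseteq> \<gamma> ` {0..1}"
    using ex_unit_cube_filling_curve by blast
  \<comment> \<open>The factor \<open>3 * R\<close> instead of \<open>2 * R\<close> places \<open>C\<close> strictly below the upper faces of the
    image cube, which the binary expansions do not cover.\<close>
  define \<delta> where "\<delta> t = (3 * R) *\<^sub>R \<gamma> t - R *\<^sub>R One" for t
  have "continuous_on UNIV \<delta>" unfolding \<delta>_def by (intro continuous_intros \<gamma>)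
  moreover have "bounded (range \<delta>)"
  proof -
    have "bounded ((\<lambda>x. x - R *\<^sub>R One) ` ((*\<^sub>R) (3 * R)) ` range \<gamma>)"
      using \<gamma>(2) by (intro bounded_translation_minus bounded_scaling)
    then show ?thesis by (simp add: \<delta>_def image_image)
  qed
  moreover have "x \<in> \<delta> ` {0..1}" if "x \<in> C" for x
  proof -
    define y where "y = (1 / (3 * R)) *\<^sub>R (x + R *\<^sub>R One)"
    have "0 \<le> y \<bullet> b \<and> y \<bullet> b < 1" if b: "b \<in> Basis" for b
    proof -
      have "\<bar>x \<bullet> b\<bar> \<le> R" using R(2)[OF \<open>x \<in> C\<close>] Basis_le_norm[OF b, of x] by linarith
      moreover have "y \<bullet> b = (x \<bullet> b + R) / (3 * R)"
        using b by (simp add: y_def inner_add_left)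
      moreover have "0 \<le> (x \<bullet> b + R) / (3 * R)" "(x \<bullet> b + R) / (3 * R) < 1"
        using \<open>\<bar>x \<bullet> b\<bar> \<le> R\<close> R(1) by (simp_all add: divide_simps)
      ultimately show ?thesis by simp
    qed
    then have "y \<in> \<gamma> ` {0..1}" using \<gamma>(3) by auto
    then obtain t where "t \<in> {0..1}" "y = \<gamma> t" by auto
    moreover have "x = (3 * R) *\<^sub>R y - R *\<^sub>R One" using R(1) by (simp add: y_def)
    ultimately show ?thesis by (auto simp: \<delta>_def)
  qed
  ultimately show ?thesis by (intro exI[of _ \<delta>]) auto
qed

text \<open>The first parameter value at which the curve visits a point depends on the point in a lower
  semicontinuous way. A continuous right inverse does not exist in general, but a Borel one suffices
  to lift measures from the image of the curve to the parameter interval.\<close>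

lemma ex_borel_right_inverse:
  fixes \<gamma> :: "real \<Rightarrow> 'a::euclidean_space"
  assumes \<gamma>: "continuous_on UNIV \<gamma>"
  shows "\<exists>h \<in> borel_measurable borel. range h \<subseteq> {0..2} \<and> (\<forall>x \<in> \<gamma> ` {0..1}. \<gamma> (h x) = x)"
proof -
  define S where "S x = {t \<in> {0..1}. \<gamma> t = x}" for x
  \<comment> \<open>Points off the curve get a value above 1, so that they stay out of the sublevel sets
    up to level 1.\<close>
  define h where "h x = (if S x = {} then 2 else Inf (S x))" for x
  have "compact (S x)" for x
  proof -
    have "closed (\<gamma> -` {x})" using \<gamma> by (intro closed_vimage) (auto simp: continuous_on_eq_continuous_at)
    moreover have "S x = {0..1} \<inter> \<gamma> -` {x}" by (auto simp: S_def)
    ultimately show ?thesis by (simp add: compact_Int_closed)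
  qed
  then have hS: "h x \<in> S x" if "S x \<noteq> {}" for x
  proof -
    have "bdd_below (S x)" by (auto simp: S_def intro!: bdd_belowI[of _ 0])
    then have "Inf (S x) \<in> S x"
      using that \<open>compact (S x)\<close> by (intro closed_contains_Inf compact_imp_closed)
    with that show ?thesis by (simp add: h_def)
  qed
  have low: "h x \<le> t" if "t \<in> S x" for x t
    using that by (auto simp: h_def S_def intro!: cInf_lower bdd_belowI[of _ 0])
  have "h x \<in> {0..2}" for x
    using hS[of x] by (cases "S x = {}") (auto simp: h_def S_def)
  moreover have "\<gamma> (h x) = x" if "x \<in> \<gamma> ` {0..1}" for x
  proof -
    obtain t where "t \<in> {0..1}" "x = \<gamma> t" using \<open>x \<in> \<gamma> ` {0..1}\<close> by blast
    then have "t \<in> S x" by (simp add: S_def)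
    then show ?thesis using hS[of x] by (auto simp: S_def)
  qed
  moreover have "h \<in> borel_measurable borel"
    unfolding borel_measurable_iff_le
  proof
    fix c :: real
    show "{w \<in> space borel. h w \<le> c} \<in> sets borel"
    proof (cases "2 \<le> c")
      case True
      have "h w \<le> c" for w using True \<open>h w \<in> {0..2}\<close> by auto
      then show ?thesis by simp
    next
      case False
      \<comment> \<open>Because \<open>h\<close> picks the first parameter of each point, its sublevel sets are compact
        initial pieces of the curve.\<close>
      have "{w \<in> space borel. h w \<le> c} = \<gamma> ` ({0..1} \<inter> {..c})"
      proof (intro equalityI subsetI)
        fix x assume "x \<in> {w \<in> space borel. h w \<le> c}"
        then have "h x \<le> c" by simp
        with False have "S x \<noteq> {}" by (auto simp: h_def)
        from hS[OF this] \<open>h x \<le> c\<close> show "x \<in> \<gamma> ` ({0..1} \<inter> {..c})" by (force simp: S_def)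
      next
        fix x assume "x \<in> \<gamma> ` ({0..1} \<inter> {..c})"
        then obtain t where "t \<in> S x" "t \<le> c" by (auto simp: S_def)
        then show "x \<in> {w \<in> space borel. h w \<le> c}" using low[of t x] by auto
      qed
      moreover have "compact (\<gamma> ` ({0..1} \<inter> {..c}))"
        by (intro compact_continuous_image continuous_on_subset[OF \<gamma>] compact_Int_closed) auto
      ultimately show ?thesis by (simp add: compact_imp_closed)
    qed
  qed
  ultimately show ?thesis by blast
qed

section \<open>Vague compactness of finite measures\<close>

text \<open>The multi-dimensional Helly selection principle, reduced to the one on the real line: lift the
  measures along a space-filling curve \<open>\<gamma>\<close> by a Borel right inverse \<open>h\<close>, select a weakly convergent
  subsequence there, and push its limit forward by \<open>\<gamma>\<close>. Weak convergence on the
  line applies to \<open>f \<circ> \<gamma>\<close>, which is continuous and bounded, and \<open>f \<circ> \<gamma> \<circ> h = f\<close> holds on \<open>C\<close>. The masses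
  may tend to 0, so they are split off and made to converge separately.\<close>

lemma vague_sequential_compactness:
  fixes M :: "nat \<Rightarrow> 'a::euclidean_space measure"
  assumes sets_M: "\<And>k. sets (M k) = sets borel"
    and fin: "\<And>k. finite_measure (M k)"
    and bd: "\<And>k. measure (M k) UNIV \<le> B"
    and C: "bounded C" "\<And>k. AE x in M k. x \<in> C"
  shows "\<exists>r \<nu>. strict_mono (r :: nat \<Rightarrow> nat) \<and> finite_measure \<nu> \<and> sets \<nu> = sets borel \<and>
    (\<exists>D. compact D \<and> (AE x in \<nu>. x \<in> D)) \<and>
    (\<forall>f :: 'a \<Rightarrow> real. continuous_on UNIV f \<longrightarrow>
       (\<lambda>k. integral\<^sup>L (M (r k)) f) \<longlonglongrightarrow> integral\<^sup>L \<nu> f)"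
proof -
  obtain \<gamma> :: "real \<Rightarrow> 'a" where \<gamma>: "continuous_on UNIV \<gamma>" "bounded (range \<gamma>)" "C \<subseteq> \<gamma> ` {0..1}"
    using ex_filling_curve[OF C(1)] by blast
  obtain h where h [measurable]: "h \<in> borel_measurable borel"
    and h02: "range h \<subseteq> {0..2}" and \<gamma>h: "\<And>x. x \<in> \<gamma> ` {0..1} \<Longrightarrow> \<gamma> (h x) = x"
    using ex_borel_right_inverse[OF \<gamma>(1)] by blast
  have [measurable]: "\<gamma> \<in> borel_measurable borel"
    by (rule borel_measurable_continuous_onI[OF \<gamma>(1)])
  note [measurable_cong] = sets_M
  have sp [simp]: "space (M k) = UNIV" for k using sets_eq_imp_space_eq[OF sets_M] by simp
  define m where "m k = measure (M k) UNIV" for k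
  have m0: "0 \<le> m k" for k by (simp add: m_def)
  have emM: "emeasure (M k) UNIV = ennreal (m k)" for k
    unfolding m_def using fin finite_measure.emeasure_eq_measure by blast
  \<comment> \<open>The normalised image on the parameter line; a null measure has no normalisation,
    and any law will do, since it is multiplied by the mass \<open>m k = 0\<close> below.\<close>
  define P where "P k = (if m k = 0 then return borel 0
      else distr (density (M k) (\<lambda>_. ennreal (1 / m k))) borel h)" for k
  have P_real: "real_distribution (P k)" for k
  proof (cases "m k = 0")
    case True
    then show ?thesis
      by (auto simp: P_def real_distribution_def real_distribution_axioms_def intro: prob_space_return)
  next
    case False
    have "prob_space (density (M k) (\<lambda>_. ennreal (1 / m k)))"
    proof
      show "emeasure (density (M k) (\<lambda>_. ennreal (1 / m k))) (space (density (M k) (\<lambda>_. ennreal (1 / m k)))) = 1"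
        using False m0[of k]
        by (simp add: emeasure_density_const emM sets_M flip: ennreal_mult)
    qed
    then have "prob_space (P k)"
      unfolding P_def using False by (simp add: prob_space.prob_space_distr)
    then show ?thesis
      using False by (simp add: P_def real_distribution_def real_distribution_axioms_def)
  qed
  have P02: "measure (P k) {-1<..2} = 1" for k
  proof (cases "m k = 0")
    case True
    then show ?thesis by (simp add: P_def measure_return)
  next
    case False
    interpret real_distribution "P k" by (rule P_real)
    have "h -` {-1<..2} = UNIV" using h02 by fastforce
    then have "emeasure (P k) {-1<..2} = emeasure (P k) UNIV"
      using False by (simp add: P_def emeasure_distr)
    also have "\<dots> = 1" using emeasure_space_1 by simp
    finally show ?thesis by (simp add: measure_def)
  qed
  have "tight P" unfolding tight_def
  proof (intro conjI allI impI)
    fix \<epsilon> :: real assume "0 < \<epsilon>"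
    then show "\<exists>a b. a < b \<and> (\<forall>n. 1 - \<epsilon> < measure (P n) {a<..b})"
      using P02 by (intro exI[of _ "-1"] exI[of _ 2]) simp
  qed (rule P_real)
  have int: "integral\<^sup>L (M k) f = m k * integral\<^sup>L (P k) (\<lambda>t. f (\<gamma> t))"
    if f: "continuous_on UNIV f" for f :: "'a \<Rightarrow> real" and k
  proof -
    have [measurable]: "f \<in> borel_measurable borel"
      by (rule borel_measurable_continuous_onI[OF f])
    have ae: "AE x in M k. f (\<gamma> (h x)) = f x"
      using C(2)[of k] by eventually_elim (use \<gamma>(3) \<gamma>h in auto)
    show ?thesis
    proof (cases "m k = 0")
      case True
      then have "emeasure (M k) (space (M k)) = 0" using emM[of k] by simp
      then have "AE x in M k. f x = 0" by (intro AE_I[of _ _ UNIV]) auto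
      then have "integral\<^sup>L (M k) f = 0" by (rule integral_eq_zero_AE)
      with True show ?thesis by simp
    next
      case False
      have "integral\<^sup>L (P k) (\<lambda>t. f (\<gamma> t)) =
          integral\<^sup>L (density (M k) (\<lambda>_. ennreal (1 / m k))) (\<lambda>x. f (\<gamma> (h x)))"
        using False by (simp add: P_def integral_distr)
      also have "\<dots> = integral\<^sup>L (M k) (\<lambda>x. (1 / m k) *\<^sub>R f (\<gamma> (h x)))"
        using m0[of k] by (subst integral_density) auto
      also have "\<dots> = (1 / m k) * integral\<^sup>L (M k) (\<lambda>x. f (\<gamma> (h x)))"
        by simp
      also have "integral\<^sup>L (M k) (\<lambda>x. f (\<gamma> (h x))) = integral\<^sup>L (M k) f"
        using ae by (intro integral_cong_AE) auto
      finally show ?thesis using False by simp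
    qed
  qed
  have "bounded (range m)"
    using m0 bd by (intro boundedI[of _ B]) (auto simp: m_def)
  then obtain s c where s: "strict_mono s" "(m \<circ> s) \<longlonglongrightarrow> c"
    using bounded_imp_convergent_subsequence by blast
  have c0: "0 \<le> c" using m0 s(2) by (intro LIMSEQ_le_const[OF s(2)]) auto
  obtain q Q where q: "strict_mono q" "real_distribution Q" "weak_conv_m (P \<circ> s \<circ> q) Q"
    using tight_imp_convergent_subsubsequence[OF \<open>tight P\<close> s(1)] by blast
  interpret Q: real_distribution Q by fact
  define \<nu> where "\<nu> = density (distr Q borel \<gamma>) (\<lambda>_. ennreal c)"
  have sets_\<nu> [simp]: "sets \<nu> = sets borel" by (simp add: \<nu>_def)
  have sm: "strict_mono (s \<circ> q)" using s(1) q(1) by (rule strict_mono_o)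
  have "finite_measure \<nu>"
  proof
    interpret D: prob_space "distr Q borel \<gamma>" by (rule Q.prob_space_distr) simp
    show "emeasure \<nu> (space \<nu>) \<noteq> \<infinity>"
      unfolding \<nu>_def using D.emeasure_space_1 by (simp add: emeasure_density_const)
  qed
  moreover have "\<exists>D. compact D \<and> (AE x in \<nu>. x \<in> D)"
  proof (intro exI conjI)
    show "compact (closure (range \<gamma>))" using \<gamma>(2) by simp
    have "AE x in distr Q borel \<gamma>. x \<in> closure (range \<gamma>)"
      by (subst AE_distr_iff) (auto intro!: AE_I2 closure_subset[THEN subsetD])
    then show "AE x in \<nu>. x \<in> closure (range \<gamma>)"
      unfolding \<nu>_def by (subst AE_density) auto
  qed
  moreover have "(\<lambda>k. integral\<^sup>L (M ((s \<circ> q) k)) f) \<longlonglongrightarrow> integral\<^sup>L \<nu> f"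
    if f: "continuous_on UNIV f" for f :: "'a \<Rightarrow> real"
  proof -
    have [measurable]: "f \<in> borel_measurable borel"
      by (rule borel_measurable_continuous_onI[OF f])
    have "compact (f ` closure (range \<gamma>))"
      using f \<gamma>(2) by (intro compact_continuous_image) (auto intro: continuous_on_subset)
    then obtain A where A: "\<And>x. x \<in> closure (range \<gamma>) \<Longrightarrow> norm (f x) \<le> A"
      using compact_imp_bounded bounded_iff by (metis image_eqI)
    have cont: "isCont (\<lambda>t. f (\<gamma> t)) t" for t
      using f \<gamma>(1) by (metis UNIV_I continuous_on_compose2 continuous_on_eq_continuous_at open_UNIV subset_UNIV)
    have "(\<lambda>k. integral\<^sup>L ((P \<circ> s \<circ> q) k) (\<lambda>t. f (\<gamma> t))) \<longlonglongrightarrow> integral\<^sup>L Q (\<lambda>t. f (\<gamma> t))"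
      by (rule weak_conv_imp_integral_bdd_continuous_conv[OF _ _ q(3) cont, of A])
         (use P_real q(2) A[OF closure_subset[THEN subsetD]] in auto)
    then have "(\<lambda>k. m (s (q k)) * integral\<^sup>L (P (s (q k))) (\<lambda>t. f (\<gamma> t)))
        \<longlonglongrightarrow> c * integral\<^sup>L Q (\<lambda>t. f (\<gamma> t))"
      using LIMSEQ_subseq_LIMSEQ[OF s(2) q(1)] by (intro tendsto_mult) (auto simp: o_def)
    moreover have "integral\<^sup>L \<nu> f = c * integral\<^sup>L Q (\<lambda>t. f (\<gamma> t))"
      unfolding \<nu>_def using c0 by (subst integral_density) (auto simp: integral_distr)
    ultimately show ?thesis by (simp add: int[OF f])
  qed
  ultimately show ?thesis using sm sets_\<nu> by blast
qed

section \<open>Integration against a difference of finite measures\<close>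

text \<open>Identities between integrals of four measures are kept additive, because differences of
  measures are not measures.\<close>

lemma nn_integral_add_measures:
  fixes N1 :: "'a::topological_space measure"
  assumes S: "sets N1 = sets borel" "sets N2 = sets borel" "sets N3 = sets borel" "sets N4 = sets borel"
    and eq: "\<And>A. A \<in> sets borel \<Longrightarrow> emeasure N1 A + emeasure N2 A = emeasure N3 A + emeasure N4 A"
    and f: "f \<in> borel_measurable borel"
  shows "integral\<^sup>N N1 f + integral\<^sup>N N2 f = integral\<^sup>N N3 f + integral\<^sup>N N4 f"
  using f
proof (induction f rule: borel_measurable_induct)
  case (cong f g)
  then show ?case using sets_eq_imp_space_eq[OF S(1)] by (simp cong: nn_integral_cong)
next
  case (set A)
  then show ?case using eq S by simp
next
  case (mult u c)
  have [measurable]: "u \<in> borel_measurable N" if "sets N = sets borel" for N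
    using mult.hyps that by (simp cong: measurable_cong_sets)
  show ?case
    using mult.IH S by (simp add: nn_integral_cmult flip: distrib_left)
next
  case (add u v)
  have [measurable]: "u \<in> borel_measurable N" "v \<in> borel_measurable N" if "sets N = sets borel" for N
    using add.hyps that by (simp_all cong: measurable_cong_sets)
  have "integral\<^sup>N N1 u + integral\<^sup>N N1 v + (integral\<^sup>N N2 u + integral\<^sup>N N2 v)
      = (integral\<^sup>N N1 u + integral\<^sup>N N2 u) + (integral\<^sup>N N1 v + integral\<^sup>N N2 v)"
    by (simp add: ac_simps)
  also have "\<dots> = integral\<^sup>N N3 u + integral\<^sup>N N3 v + (integral\<^sup>N N4 u + integral\<^sup>N N4 v)"
    by (simp add: add.IH ac_simps)
  finally show ?case using S by (simp add: nn_integral_add add.commute)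
next
  case (seq U)
  have m: "U i \<in> borel_measurable N" if "sets N = sets borel" for N i
    using seq.hyps that by (simp cong: measurable_cong_sets)
  have *: "(\<integral>\<^sup>+ x. (SUP i. U i) x \<partial>N) = (SUP i. integral\<^sup>N N (U i))" if "sets N = sets borel" for N
    using nn_integral_monotone_convergence_SUP[OF \<open>incseq U\<close> m[OF that]] by (simp add: image_image)
  have inc: "incseq (\<lambda>i. integral\<^sup>N N (U i))" for N
    using \<open>incseq U\<close> by (auto simp: incseq_def le_fun_def intro!: nn_integral_mono)
  show ?case
    unfolding *[OF S(1)] *[OF S(2)] *[OF S(3)] *[OF S(4)]
    by (simp add: inc seq.IH ennreal_SUP_add[symmetric])
qed

lemma integral_add_measures:
  fixes N1 :: "'a::topological_space measure" and f :: "'a \<Rightarrow> real"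
  assumes S: "sets N1 = sets borel" "sets N2 = sets borel" "sets N3 = sets borel" "sets N4 = sets borel"
    and eq: "\<And>A. A \<in> sets borel \<Longrightarrow> emeasure N1 A + emeasure N2 A = emeasure N3 A + emeasure N4 A"
    and I: "integrable N1 f" "integrable N2 f" "integrable N3 f" "integrable N4 f"
  shows "integral\<^sup>L N1 f + integral\<^sup>L N2 f = integral\<^sup>L N3 f + integral\<^sup>L N4 f"
proof -
  have f [measurable]: "f \<in> borel_measurable borel"
    using I(1) S(1) by (simp add: borel_measurable_integrable cong: measurable_cong_sets)
  have fin: "(\<integral>\<^sup>+x. ennreal (g x) \<partial>N) \<noteq> \<infinity>" if "integrable N f" "g = f \<or> g = (\<lambda>x. - f x)" for N g
    using that by (auto simp: real_integrable_def)
  have part: "enn2real (integral\<^sup>N N1 (\<lambda>x. ennreal (g x))) + enn2real (integral\<^sup>N N2 (\<lambda>x. ennreal (g x)))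
     = enn2real (integral\<^sup>N N3 (\<lambda>x. ennreal (g x))) + enn2real (integral\<^sup>N N4 (\<lambda>x. ennreal (g x)))"
    if g: "g = f \<or> g = (\<lambda>x. - f x)" for g
  proof -
    have "(\<lambda>x. ennreal (g x)) \<in> borel_measurable borel" using g by auto
    from nn_integral_add_measures[OF S eq this]
    show ?thesis
      using fin[OF I(1) g] fin[OF I(2) g] fin[OF I(3) g] fin[OF I(4) g]
      by (simp flip: enn2real_plus add: less_top)
  qed
  show ?thesis
    unfolding I[THEN real_lebesgue_integral_def] using part[of f] part[of "\<lambda>x. - f x"] by simp
qed

text \<open>On a Hahn set \<open>Y\<close> the difference is nonnegative and off \<open>Y\<close> it is nonpositive, so among the
  Borel subsets \<open>B\<close> of \<open>A\<close> the value at \<open>B\<close> is largest for \<open>B = A \<inter> Y\<close>. This closed form is countably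
  additive, and therefore the supremum in the definition of the positive variation really is a measure.\<close>

lemma pos_variation_diff:
  fixes P Q :: "'a::topological_space measure"
  assumes S: "sets P = sets borel" "sets Q = sets borel"
    and "finite_measure P" "finite_measure Q"
    and Y: "Y \<in> sets borel"
    and pos: "\<And>X. X \<in> sets borel \<Longrightarrow> X \<subseteq> Y \<Longrightarrow> emeasure Q X \<le> emeasure P X"
    and neg: "\<And>X. X \<in> sets borel \<Longrightarrow> X \<inter> Y = {} \<Longrightarrow> emeasure P X \<le> emeasure Q X"
    and A: "A \<in> sets borel"
  shows "emeasure (pos_variation (\<lambda>B. measure P B - measure Q B)) A
    = ennreal (measure P (A \<inter> Y) - measure Q (A \<inter> Y))"
proof -
  interpret P: finite_measure P by fact
  interpret Q: finite_measure Q by fact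
  define d where "d B = measure P B - measure Q B" for B
  have d_pos: "0 \<le> d X" if "X \<in> sets borel" "X \<subseteq> Y" for X
    using pos[OF that] by (simp add: d_def P.emeasure_eq_measure Q.emeasure_eq_measure)
  have d_neg: "d X \<le> 0" if "X \<in> sets borel" "X \<inter> Y = {}" for X
    using neg[OF that] by (simp add: d_def P.emeasure_eq_measure Q.emeasure_eq_measure)
  have d_Un: "d (X \<union> Z) = d X + d Z" if "X \<in> sets borel" "Z \<in> sets borel" "X \<inter> Z = {}" for X Z
    using that S by (simp add: d_def P.finite_measure_Union Q.finite_measure_Union)
  have d_sums: "(\<lambda>i. d (B i)) sums d (\<Union>i. B i)"
    if "range B \<subseteq> sets borel" "disjoint_family B" for B :: "nat \<Rightarrow> 'a set"
    unfolding d_def using that S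
    by (intro sums_diff P.finite_measure_UNION Q.finite_measure_UNION) auto
  have sup: "(SUP B \<in> {B \<in> sets borel. B \<subseteq> A}. ennreal (d B)) = ennreal (d (A \<inter> Y))"
    if A: "A \<in> sets borel" for A
  proof (rule antisym)
    show "(SUP B \<in> {B \<in> sets borel. B \<subseteq> A}. ennreal (d B)) \<le> ennreal (d (A \<inter> Y))"
    proof (rule SUP_least)
      fix B assume "B \<in> {B \<in> sets borel. B \<subseteq> A}"
      then have B: "B \<in> sets borel" "B \<subseteq> A" by auto
      have "d B = d (B \<inter> Y) + d (B - Y)"
        using d_Un[of "B \<inter> Y" "B - Y"] B Y by (simp add: Int_Diff_Un Int_Diff_disjoint)
      moreover have "d (A \<inter> Y) = d (B \<inter> Y) + d ((A - B) \<inter> Y)"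
      proof -
        have "A \<inter> Y = (B \<inter> Y) \<union> ((A - B) \<inter> Y)" using B by auto
        then show ?thesis using d_Un[of "B \<inter> Y" "(A - B) \<inter> Y"] A B Y by auto
      qed
      moreover have "d (B - Y) \<le> 0" using B Y by (intro d_neg) auto
      moreover have "0 \<le> d ((A - B) \<inter> Y)" using A B Y by (intro d_pos) auto
      ultimately show "ennreal (d B) \<le> ennreal (d (A \<inter> Y))" by (intro ennreal_leI) simp
    qed
    show "ennreal (d (A \<inter> Y)) \<le> (SUP B \<in> {B \<in> sets borel. B \<subseteq> A}. ennreal (d B))"
      using A Y by (intro SUP_upper) auto
  qed
  have "emeasure (pos_variation d) A = (SUP B \<in> {B \<in> sets borel. B \<subseteq> A}. ennreal (d B))"
    unfolding pos_variation_def
  proof (rule emeasure_measure_of_sigma)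
    show "sigma_algebra UNIV (sets (borel :: 'a measure))"
      using sets.sigma_algebra_axioms[of "borel :: 'a measure"] by simp
    have "d {} = 0" by (simp add: d_def)
    then show "positive (sets borel) (\<lambda>A. SUP B \<in> {B \<in> sets borel. B \<subseteq> A}. ennreal (d B))"
      unfolding positive_def by (subst sup) auto
    show "countably_additive (sets borel) (\<lambda>A. SUP B \<in> {B \<in> sets borel. B \<subseteq> A}. ennreal (d B))"
    proof (rule countably_additiveI)
      fix B :: "nat \<Rightarrow> 'a set"
      assume B: "range B \<subseteq> sets borel" "disjoint_family B" "(\<Union>i. B i) \<in> sets borel"
      have "(\<lambda>i. d (B i \<inter> Y)) sums d (\<Union>i. B i \<inter> Y)"
        using B Y by (intro d_sums) (auto simp: disjoint_family_on_def)
      moreover have "0 \<le> d (B i \<inter> Y)" for i using B Y by (intro d_pos) auto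
      ultimately have "(\<Sum>i. ennreal (d (B i \<inter> Y))) = ennreal (d (\<Union>i. B i \<inter> Y))"
        by (simp add: suminf_ennreal2 sums_iff)
      moreover have "(\<Union>i. B i \<inter> Y) = (\<Union>i. B i) \<inter> Y" by auto
      ultimately show "(\<Sum>i. SUP X \<in> {X \<in> sets borel. X \<subseteq> B i}. ennreal (d X))
          = (SUP X \<in> {X \<in> sets borel. X \<subseteq> (\<Union>i. B i)}. ennreal (d X))"
        using B sup by (simp add: range_subsetD)
    qed
  qed fact
  moreover have "(\<lambda>B. measure P B - measure Q B) = d" by (simp add: d_def[abs_def])
  ultimately show ?thesis unfolding sup[OF A] by (simp add: d_def)
qed

lemma sets_pos_variation [simp]: "sets (pos_variation \<mu>) = sets borel"
  unfolding pos_variation_def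
  using sets.sigma_sets_eq[of "borel :: 'a::topological_space measure"] by (simp add: sets_measure_of)

lemma signed_borel_measure_diff:
  assumes S: "sets P = sets borel" "sets Q = sets borel"
    and "finite_measure P" "finite_measure Q"
  shows "signed_borel_measure (\<lambda>B. measure P B - measure Q B)"
proof -
  interpret P: finite_measure P by fact
  interpret Q: finite_measure Q by fact
  show ?thesis unfolding signed_borel_measure_def using S
    by (auto intro!: sums_diff P.finite_measure_UNION Q.finite_measure_UNION)
qed

text \<open>The integral against a signed measure does not depend on how the signed measure is written as a
  difference: with the Jordan parts \<open>\<mu>\<^sup>+\<close> and \<open>\<mu>\<^sup>-\<close> of \<open>P - Q\<close> one has \<open>\<mu>\<^sup>+ + Q = \<mu>\<^sup>- + P\<close>. The Jordan
  parts live on \<open>X\<close>, even though \<open>P\<close> and \<open>Q\<close> may share mass outside \<open>X\<close>.\<close>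

lemma signed_set_integral_diff:
  fixes P Q :: "'a::euclidean_space measure" and f :: "'a \<Rightarrow> real"
  assumes S: "sets P = sets borel" "sets Q = sets borel"
    and finP: "finite_measure P" and finQ: "finite_measure Q"
    and X: "compact X"
    and off: "\<And>B. B \<in> sets borel \<Longrightarrow> B \<subseteq> - X \<Longrightarrow> measure P B = measure Q B"
    and f: "continuous_on UNIV f"
    and I: "integrable P f" "integrable Q f"
  shows "signed_set_integral (\<lambda>B. measure P B - measure Q B) X f = integral\<^sup>L P f - integral\<^sup>L Q f"
proof -
  interpret P: finite_measure P by fact
  interpret Q: finite_measure Q by fact
  define \<mu> where "\<mu> B = measure P B - measure Q B" for B
  have \<mu>_minus: "(\<lambda>A. - \<mu> A) = (\<lambda>B. measure Q B - measure P B)" by (auto simp: \<mu>_def)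
  have "sets Q = sets P" using S by simp
  from finite_unsigned_Hahn_decomposition[OF finP finQ this]
  obtain Y where Y: "Y \<in> sets borel"
    and pos: "\<And>X. X \<in> sets borel \<Longrightarrow> X \<subseteq> Y \<Longrightarrow> emeasure Q X \<le> emeasure P X"
    and neg: "\<And>X. X \<in> sets borel \<Longrightarrow> X \<inter> Y = {} \<Longrightarrow> emeasure P X \<le> emeasure Q X"
    using S by metis
  have em_pos: "emeasure (pos_variation \<mu>) A = ennreal (\<mu> (A \<inter> Y))" if "A \<in> sets borel" for A
    unfolding \<mu>_def by (rule pos_variation_diff[OF S finP finQ Y pos neg that])
  have em_neg: "emeasure (neg_variation \<mu>) A = ennreal (- \<mu> (A - Y))" if "A \<in> sets borel" for A
  proof -
    have "emeasure (neg_variation \<mu>) A = ennreal (measure Q (A \<inter> - Y) - measure P (A \<inter> - Y))"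
      unfolding neg_variation_def \<mu>_minus
      by (rule pos_variation_diff[OF S(2,1) finQ finP _ _ _ that]) (use Y pos neg in auto)
    then show ?thesis by (simp add: \<mu>_def Diff_eq)
  qed
  have sets_neg [simp]: "sets (neg_variation \<mu>) = sets borel" by (simp add: neg_variation_def)
  have bal: "emeasure (pos_variation \<mu>) A + emeasure Q A = emeasure (neg_variation \<mu>) A + emeasure P A"
    if A: "A \<in> sets borel" for A
  proof -
    have "0 \<le> \<mu> (A \<inter> Y)" "0 \<le> - \<mu> (A - Y)"
      using pos[of "A \<inter> Y"] neg[of "A - Y"] A Y
      by (auto simp: \<mu>_def P.emeasure_eq_measure Q.emeasure_eq_measure)
    moreover have "measure P A = measure P (A \<inter> Y) + measure P (A - Y)"
      using P.finite_measure_Union[of "A \<inter> Y" "A - Y"] A Y S by (simp add: Int_Diff_Un Int_Diff_disjoint)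
    moreover have "measure Q A = measure Q (A \<inter> Y) + measure Q (A - Y)"
      using Q.finite_measure_Union[of "A \<inter> Y" "A - Y"] A Y S by (simp add: Int_Diff_Un Int_Diff_disjoint)
    ultimately show ?thesis
      by (simp add: em_pos em_neg A P.emeasure_eq_measure Q.emeasure_eq_measure \<mu>_def flip: ennreal_plus)
  qed
  have Xb [measurable]: "X \<in> sets borel" using X by (simp add: compact_imp_closed)
  have off0: "\<mu> B = 0" if "B \<in> sets borel" "B \<subseteq> - X" for B
    using off[OF that] by (simp add: \<mu>_def)
  obtain A where A: "\<And>x. x \<in> X \<Longrightarrow> norm (f x) \<le> A"
    using compact_continuous_image[OF continuous_on_subset[OF f] X] compact_imp_bounded bounded_iff
    by (metis image_eqI subset_UNIV)
  have [measurable]: "f \<in> borel_measurable borel"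
    by (rule borel_measurable_continuous_onI[OF f])
  have carried: "integrable N f \<and> (LINT x:X|N. f x) = integral\<^sup>L N f"
    if N: "sets N = sets borel" "emeasure N (- X) = 0" "emeasure N UNIV \<noteq> \<infinity>" for N
  proof -
    note [measurable_cong] = N(1)
    have sp: "space N = UNIV" using sets_eq_imp_space_eq[OF N(1)] by simp
    interpret N: finite_measure N by (rule finite_measureI) (use N(3) in \<open>simp add: sp\<close>)
    have ae: "AE x in N. x \<in> X"
      by (rule AE_I[OF _ N(2)]) (use N(1) Xb in \<open>auto simp: sp\<close>)
    have "AE x in N. norm (f x) \<le> A" using ae by eventually_elim (rule A)
    then have "integrable N f" by (rule N.integrable_const_bound) measurable
    moreover have "AE x in N. indicator X x *\<^sub>R f x = f x" using ae by eventually_elim simp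
    then have "(LINT x:X|N. f x) = integral\<^sup>L N f"
      unfolding set_lebesgue_integral_def by (rule integral_cong_AE[rotated 2]) measurable
    ultimately show ?thesis by simp
  qed
  have "emeasure (pos_variation \<mu>) (- X) = 0" "emeasure (neg_variation \<mu>) (- X) = 0"
    using Xb Y by (simp_all add: em_pos em_neg off0 Int_lower1 Diff_subset)
  then have *: "integrable (pos_variation \<mu>) f \<and> (LINT x:X|pos_variation \<mu>. f x) = integral\<^sup>L (pos_variation \<mu>) f"
      "integrable (neg_variation \<mu>) f \<and> (LINT x:X|neg_variation \<mu>. f x) = integral\<^sup>L (neg_variation \<mu>) f"
    by (intro carried; simp add: em_pos em_neg)+
  have "integral\<^sup>L (pos_variation \<mu>) f + integral\<^sup>L Q f = integral\<^sup>L (neg_variation \<mu>) f + integral\<^sup>L P f"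
    by (rule integral_add_measures) (use S bal * I in auto)
  then have "signed_set_integral \<mu> X f = integral\<^sup>L P f - integral\<^sup>L Q f"
    unfolding signed_set_integral_def using * by simp
  then show ?thesis by (simp add: \<mu>_def[abs_def])
qed

section \<open>Total variation of the difference quotients\<close>

text \<open>The Banach-Steinhaus theorem, by the usual category argument: the closed sets of points at which
  all operators are bounded by \<open>n\<close> cover the space, so one of them contains a ball.\<close>

lemma uniform_boundedness:
  fixes T :: "nat \<Rightarrow> 'a::{real_normed_vector, complete_space} \<Rightarrow> 'b::real_normed_vector"
  assumes lin: "\<And>k. bounded_linear (T k)"
    and pt: "\<And>x. bounded (range (\<lambda>k. T k x))"
  shows "\<exists>B\<ge>0. \<forall>k x. norm (T k x) \<le> B * norm x"
proof -
  define F where "F n = {x. \<forall>k. norm (T k x) \<le> real n}" for n :: nat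
  have "F n = (\<Inter>k. {x. norm (T k x) \<le> real n})" for n by (auto simp: F_def)
  moreover have "closed {x. norm (T k x) \<le> real n}" for k n
    by (intro closed_Collect_le continuous_intros linear_continuous_on lin)
  ultimately have clF: "closed (F n)" for n by auto
  have "\<exists>n. x \<in> F n" for x
  proof -
    obtain b where "\<And>k. norm (T k x) \<le> b" using pt[of x] by (auto simp: bounded_iff)
    moreover obtain n where "b \<le> real n" using real_arch_simple by blast
    ultimately show ?thesis unfolding F_def by (auto intro: order_trans)
  qed
  then have UF: "\<Union>(range F) = UNIV" by auto
  have "\<exists>n. interior (F n) \<noteq> {}"
  proof (rule ccontr)
    assume "\<not> ?thesis"
    then have "\<And>S. S \<in> range F \<Longrightarrow> closedin euclidean S \<and> euclidean interior_of S = {}"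
      using clF by (auto simp: interior_of_def interior_def)
    then have "(euclidean :: 'a topology) interior_of \<Union>(range F) = {}"
      using Met_TC.metric_Baire_category_alt[where ?'a = 'a, of "range F"] complete_UNIV by auto
    then show False by (simp add: UF)
  qed
  then obtain n x where "x \<in> interior (F n)" by blast
  then obtain e where e: "e > 0" "ball x e \<subseteq> F n" by (metis mem_interior)
  have "norm (T k y) \<le> 4 * real n / e * norm y" for k y
  proof (cases "y = 0")
    case True
    then show ?thesis using linear_simps(3)[OF lin] by simp
  next
    case False
    \<comment> \<open>With this factor \<open>x + a *\<^sub>R y\<close> stays in the ball.\<close>
    define a where "a = e / (2 * norm y)"
    have a: "a > 0" using e False by (simp add: a_def)
    interpret T: bounded_linear "T k" by (rule lin)
    have "x + a *\<^sub>R y \<in> ball x e" using False e by (simp add: dist_norm a_def)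
    then have "norm (T k (x + a *\<^sub>R y)) \<le> n" "norm (T k x) \<le> n"
      using e by (auto simp: F_def subset_iff)
    moreover have "a *\<^sub>R T k y = T k (x + a *\<^sub>R y) - T k x" by (simp add: T.add T.scaleR)
    ultimately have "norm (a *\<^sub>R T k y) \<le> 2 * n"
      using norm_triangle_ineq4[of "T k (x + a *\<^sub>R y)" "T k x"] by simp
    then show ?thesis using a False e by (simp add: a_def field_simps)
  qed
  moreover have "0 \<le> 4 * real n / e" using e by simp
  ultimately show ?thesis by blast
qed

lemma set_integrable_compact:
  fixes f :: "'a::euclidean_space \<Rightarrow> real"
  assumes "compact A" "continuous_on UNIV f"
  shows "set_integrable lborel A f"
  unfolding set_integrable_def
  using assms by (intro borel_integrable_compact continuous_on_subset[OF assms(2)]) auto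

lemma bounded_linear_set_integral_bcontfun:
  fixes A :: "'a::euclidean_space set"
  assumes A: "compact A"
  shows "bounded_linear (\<lambda>g :: 'a \<Rightarrow>\<^sub>C real. LINT x:A|lborel. g x)"
proof (rule bounded_linear_intro[of _ "measure lborel A"])
  fix f g :: "'a \<Rightarrow>\<^sub>C real" and r :: real
  show "(LINT x:A|lborel. (f + g) x) = (LINT x:A|lborel. f x) + (LINT x:A|lborel. g x)"
    by (simp add: plus_bcontfun.rep_eq set_integral_add(2) set_integrable_compact A)
  show "(LINT x:A|lborel. (r *\<^sub>R f) x) = r *\<^sub>R (LINT x:A|lborel. f x)"
    by (simp add: scaleR_bcontfun.rep_eq)
  have fin: "emeasure lborel A < \<infinity>" by (rule emeasure_compact_finite[OF A])
  have "norm (LINT x:A|lborel. f x) \<le> (LINT x:A|lborel. norm (f x))"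
    by (rule set_integral_norm_bound) (simp add: set_integrable_compact A)
  also have "\<dots> \<le> (LINT x:A|lborel. norm f)"
    by (rule set_integral_mono)
       (use norm_bounded[of f] in \<open>auto intro!: set_integrable_compact A continuous_intros\<close>)
  also have "\<dots> = norm f * measure lborel A"
    using A fin by (simp add: set_lebesgue_integral_def compact_imp_closed)
  finally show "norm (LINT x:A|lborel. f x) \<le> norm f * measure lborel A" .
qed


lemma distance_cutoff_tendsto_indicator:
  assumes "closed A" "A \<noteq> {}"
  shows "(\<lambda>m. max 0 (1 - real m * infdist x A)) \<longlonglongrightarrow> indicator A x"
proof (cases "x \<in> A")
  case True
  then show ?thesis by simp
next
  case False
  then have pos: "infdist x A > 0"
    using assms by (metis in_closed_iff_infdist_zero infdist_nonneg less_eq_real_def)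
  then obtain N :: nat where N: "1 < real N * infdist x A" using reals_Archimedean3 by blast
  have "eventually (\<lambda>m. max 0 (1 - real m * infdist x A) = indicator A x) sequentially"
    using eventually_ge_at_top[of N]
  proof eventually_elim
    case (elim m)
    then have "real N * infdist x A \<le> real m * infdist x A" using pos by simp
    with N False show ?case by simp
  qed
  then show ?thesis by (rule tendsto_eventually)
qed

text \<open>The volume of the symmetric difference is the total variation of the signed measure with density
  \<open>indicator A - indicator B\<close>. It is approached by testing against the cutoffs \<open>g m\<close>, which converge
  pointwise to that density and stay in the unit ball.\<close>

lemma volume_symm_diff_le:
  fixes A B :: "'a::euclidean_space set"
  assumes A: "compact A" "A \<noteq> {}" and B: "compact B" "B \<noteq> {}"
    and bd: "\<And>g. norm (g :: 'a \<Rightarrow>\<^sub>C real) \<le> 1 \<Longrightarrow>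
       \<bar>(LINT x:A|lborel. apply_bcontfun g x) - (LINT x:B|lborel. apply_bcontfun g x)\<bar> \<le> c"
  shows "measure lborel (A - B) + measure lborel (B - A) \<le> c"
proof -
  define g where "g m x = max 0 (1 - real m * infdist x A) - max 0 (1 - real m * infdist x B)"
    for m and x :: 'a
  have g1: "\<bar>g m x\<bar> \<le> 1" for m x
  proof -
    have "0 \<le> max 0 (1 - real m * infdist x S)" "max 0 (1 - real m * infdist x S) \<le> 1" for S
      using mult_nonneg_nonneg[of "real m" "infdist x S"] by (auto simp: infdist_nonneg)
    from this[of A] this[of B] show ?thesis unfolding g_def by linarith
  qed
  have gc: "continuous_on UNIV (g m)" for m
    unfolding g_def by (intro continuous_intros)
  have [measurable]: "A \<in> sets borel" "B \<in> sets borel" using A B by (auto simp: compact_imp_closed)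
  have [measurable]: "g m \<in> borel_measurable borel" for m
    by (rule borel_measurable_continuous_onI[OF gc])
  define d where "d x = indicator A x - (indicator B x :: real)" for x :: 'a
  have [measurable]: "d \<in> borel_measurable borel" unfolding d_def by measurable
  have le: "(\<integral>x. d x * g m x \<partial>lborel) \<le> c" for m
  proof -
    have gb: "g m \<in> bcontfun" by (rule bcontfun_normI[OF gc, of _ 1]) (simp add: g1)
    define G where "G = Bcontfun (g m)"
    have G: "apply_bcontfun G = g m" unfolding G_def by (rule Bcontfun_inverse[OF gb])
    have "norm G \<le> 1" by (rule norm_bound) (simp add: G g1)
    then have "(LINT x:A|lborel. g m x) - (LINT x:B|lborel. g m x) \<le> c"
      using bd[of G] by (simp add: G)
    moreover have "(LINT x:A|lborel. g m x) - (LINT x:B|lborel. g m x) = (\<integral>x. d x * g m x \<partial>lborel)"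
      using set_integrable_compact[OF A(1) gc] set_integrable_compact[OF B(1) gc]
      unfolding set_lebesgue_integral_def set_integrable_def
      by (subst Bochner_Integration.integral_diff[symmetric]) (auto simp: d_def algebra_simps)
    ultimately show ?thesis by simp
  qed
  have fin: "emeasure lborel A < \<infinity>" "emeasure lborel B < \<infinity>"
    using A B emeasure_compact_finite by auto
  have lim: "(\<lambda>m. \<integral>x. d x * g m x \<partial>lborel) \<longlonglongrightarrow> (\<integral>x. d x * d x \<partial>lborel)"
  proof (rule integral_dominated_convergence[where w = "\<lambda>x. indicator A x + indicator B x"])
    show "integrable lborel (\<lambda>x. indicator A x + indicator B x :: real)" using fin by auto
    have "(\<lambda>m. g m x) \<longlonglongrightarrow> d x" for x
      unfolding g_def d_def using A B
      by (intro tendsto_diff distance_cutoff_tendsto_indicator compact_imp_closed)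
    then show "AE x in lborel. (\<lambda>m. d x * g m x) \<longlonglongrightarrow> d x * d x"
      by (intro AE_I2 tendsto_intros)
    show "AE x in lborel. norm (d x * g m x) \<le> indicator A x + indicator B x" for m
      by (intro AE_I2) (use g1 in \<open>auto simp: d_def indicator_def abs_mult\<close>)
  qed measurable
  have "(\<integral>x. d x * d x \<partial>lborel) = (\<integral>x. indicator (A - B) x + indicator (B - A) x \<partial>lborel)"
    by (intro Bochner_Integration.integral_cong) (auto simp: d_def indicator_def)
  also have "\<dots> = measure lborel (A - B) + measure lborel (B - A)"
  proof -
    have "emeasure lborel (A - B) < \<infinity>" "emeasure lborel (B - A) < \<infinity>"
      using fin emeasure_mono[of "A - B" A lborel] emeasure_mono[of "B - A" B lborel] by auto
    then show ?thesis by simp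
  qed
  finally show ?thesis using LIMSEQ_le_const2[OF lim] le by auto
qed

text \<open>Pointwise boundedness of the functionals \<open>T k\<close> on the Banach space of bounded continuous
  functions is turned into a bound on their norms, that is, on total variations.\<close>

lemma volume_symm_diff_quotient_bounded:
  fixes A :: "nat \<Rightarrow> 'a::euclidean_space set" and B :: "'a set" and c :: "nat \<Rightarrow> real"
  assumes A: "\<And>k. compact (A k)" "\<And>k. A k \<noteq> {}" and B: "compact B" "B \<noteq> {}"
    and bd: "\<And>f. continuous_on UNIV f \<Longrightarrow>
      bounded (range (\<lambda>k. c k * ((LINT x:A k|lborel. f x) - (LINT x:B|lborel. f x))))"
  shows "\<exists>V. \<forall>k. \<bar>c k\<bar> * (measure lborel (A k - B) + measure lborel (B - A k)) \<le> V"
proof -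
  define T where "T k g = c k * ((LINT x:A k|lborel. g x) - (LINT x:B|lborel. g x))"
    for k and g :: "'a \<Rightarrow>\<^sub>C real"
  have "bounded_linear (T k)" for k
    unfolding T_def
    by (intro bounded_linear_const_mult bounded_linear_sub bounded_linear_set_integral_bcontfun A B)
  moreover have "bounded (range (\<lambda>k. T k g))" for g
    unfolding T_def by (rule bd) simp
  ultimately obtain V where V0: "0 \<le> V" and V: "\<And>k g. norm (T k g) \<le> V * norm g"
    using uniform_boundedness[of T] by blast
  have "\<bar>c k\<bar> * (measure lborel (A k - B) + measure lborel (B - A k)) \<le> V" for k
  proof (cases "c k = 0")
    case True
    then show ?thesis using V0 by simp
  next
    case False
    have "measure lborel (A k - B) + measure lborel (B - A k) \<le> V / \<bar>c k\<bar>"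
    proof (rule volume_symm_diff_le[OF A B])
      fix g :: "'a \<Rightarrow>\<^sub>C real" assume "norm g \<le> 1"
      then have "V * norm g \<le> V * 1" by (intro mult_left_mono V0)
      then have "\<bar>c k * ((LINT x:A k|lborel. g x) - (LINT x:B|lborel. g x))\<bar> \<le> V"
        using V[of k g] by (simp add: T_def)
      then show "\<bar>(LINT x:A k|lborel. g x) - (LINT x:B|lborel. g x)\<bar> \<le> V / \<bar>c k\<bar>"
        using False unfolding abs_mult by (simp add: pos_le_divide_eq mult.commute)
    qed
    then show ?thesis using False by (simp add: field_simps)
  qed
  then show ?thesis by blast
qed

section \<open>From convergence of integrals to convergence of convex bodies\<close>

lemma set_integral_ge_ball:
  fixes f :: "'a::euclidean_space \<Rightarrow> real"
  assumes f: "continuous_on UNIV f" and f0: "\<And>x. 0 \<le> f x" and A: "compact A"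
    and ball: "ball z r \<subseteq> A" "\<And>x. x \<in> ball z r \<Longrightarrow> c \<le> f x"
  shows "c * measure lborel (ball z r) \<le> (LINT x:A|lborel. f x)"
proof -
  have iA: "set_integrable lborel A f" by (rule set_integrable_compact[OF A f])
  have iB: "set_integrable lborel (ball z r) f"
    by (rule set_integrable_subset[OF iA]) (use ball in auto)
  have fin: "emeasure lborel (ball z r) < \<infinity>" by (rule emeasure_bounded_finite) simp
  then have ic: "set_integrable lborel (ball z r) (\<lambda>_. c)"
    unfolding set_integrable_def by simp
  have "c * measure lborel (ball z r) = (LINT x:ball z r|lborel. c)"
    using fin by (simp add: set_lebesgue_integral_def)
  also have "\<dots> \<le> (LINT x:ball z r|lborel. f x)"
    by (rule set_integral_mono[OF ic iB]) (use ball in auto)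
  also have "\<dots> \<le> (LINT x:A|lborel. f x)"
    using iA iB ball(1) f0 unfolding set_lebesgue_integral_def set_integrable_def
    by (intro integral_mono) (auto simp: indicator_def)
  finally show ?thesis .
qed

lemma measure_lborel_ball_pos: "0 < r \<Longrightarrow> 0 < measure lborel (ball (z::'a::euclidean_space) r)"
  using content_ball_pos[of r z] by simp

lemma measure_lborel_ball_translate:
  fixes z w :: "'a::euclidean_space"
  assumes "0 \<le> r"
  shows "measure lborel (ball z r) = measure lborel (ball w r)"
  using content_ball_conv_unit_ball[OF assms, of z] content_ball_conv_unit_ball[OF assms, of w] by simp

lemma integral_point_reflection:
  fixes f :: "'a::euclidean_space \<Rightarrow> real"
  assumes [measurable]: "f \<in> borel_measurable borel"
  shows "(\<integral>y. f (2 *\<^sub>R x - y) \<partial>lborel) = (\<integral>y. f y \<partial>lborel)"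
proof -
  have "lborel = distr lborel borel (\<lambda>y. 2 *\<^sub>R x + (-1) *\<^sub>R y :: 'a)"
    using lborel_affine[of "-1" "2 *\<^sub>R x"] by (simp add: density_1)
  then have "(\<integral>y. f y \<partial>lborel) = (\<integral>y. f y \<partial>distr lborel borel (\<lambda>y. 2 *\<^sub>R x + (-1) *\<^sub>R y))"
    by simp
  also have "\<dots> = (\<integral>y. f (2 *\<^sub>R x + (-1) *\<^sub>R y) \<partial>lborel)"
    by (rule integral_distr) auto
  finally show ?thesis by simp
qed

text \<open>A hyperplane through \<open>x\<close> bounds an open half-space containing \<open>K\<close>, so \<open>K\<close> is disjoint from its
  reflection in \<open>x\<close>, which carries the same part of the symmetric integral.\<close>

lemma symmetric_integral_le_half:
  fixes f :: "'a::euclidean_space \<Rightarrow> real"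
  assumes f: "integrable lborel f" "\<And>y. 0 \<le> f y" "\<And>y. f (2 *\<^sub>R x - y) = f y"
    and K: "closed K" "convex K" "x \<notin> K"
  shows "2 * (LINT y:K|lborel. f y) \<le> (\<integral>y. f y \<partial>lborel)"
proof -
  obtain a b where ab: "a \<bullet> x < b" "\<And>y. y \<in> K \<Longrightarrow> b < a \<bullet> y"
    using separating_hyperplane_closed_point[OF K(2,1,3)] by blast
  have [measurable]: "f \<in> borel_measurable borel" using f(1) by auto
  have [measurable]: "K \<in> sets borel" using K by auto
  define g where "g y = indicator K y * f y" for y
  have [measurable]: "g \<in> borel_measurable borel" unfolding g_def by measurable
  have ig: "integrable lborel g"
    by (rule Bochner_Integration.integrable_bound[OF f(1)])
       (auto simp: g_def indicator_def f(2))
  have ig': "integrable lborel (\<lambda>y. g (2 *\<^sub>R x - y))"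
    by (rule Bochner_Integration.integrable_bound[OF f(1)])
       (auto simp: g_def indicator_def f(2,3))
  have "a \<bullet> (2 *\<^sub>R x - y) < b" if "y \<in> K" for y
    using ab(1) ab(2)[OF that] by (simp add: inner_diff_right)
  then have "2 *\<^sub>R x - y \<notin> K" if "y \<in> K" for y
    using ab(2) that by (meson less_asym)
  then have le: "g y + g (2 *\<^sub>R x - y) \<le> f y" for y
    using f(2,3) by (auto simp: g_def indicator_def)
  have "2 * (\<integral>y. g y \<partial>lborel) = (\<integral>y. g y + g (2 *\<^sub>R x - y) \<partial>lborel)"
    using ig ig' integral_point_reflection[of g x] by simp
  also have "\<dots> \<le> (\<integral>y. f y \<partial>lborel)"
    using ig ig' f(1) le by (intro integral_mono) auto
  finally show ?thesis by (simp add: set_lebesgue_integral_def g_def)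
qed

text \<open>Test with a bump that is symmetric about \<open>x\<close> and supported in \<open>B\<close>: a convex body missing \<open>x\<close>
  would see at most half of its positive integral.\<close>

lemma eventually_mem_of_integrals_tendsto:
  fixes K :: "'i \<Rightarrow> 'a::euclidean_space set"
  assumes K: "\<And>i. compact (K i)" "\<And>i. convex (K i)" and B: "compact B"
    and lim: "\<And>f. continuous_on UNIV f \<Longrightarrow>
      ((\<lambda>i. LINT y:K i|lborel. f y) \<longlongrightarrow> (LINT y:B|lborel. f y :: real)) F"
    and x: "x \<in> interior B"
  shows "eventually (\<lambda>i. x \<in> K i) F"
proof -
  obtain r where r: "r > 0" "cball x r \<subseteq> B" using x by (metis mem_interior_cball)
  define f where "f y = max 0 (r - dist x y)" for y
  have fc: "continuous_on UNIV f" unfolding f_def by (intro continuous_intros)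
  have f0: "0 \<le> f y" for y by (simp add: f_def)
  have sym: "f (2 *\<^sub>R x - y) = f y" for y
    by (simp add: f_def dist_norm scaleR_2 norm_minus_commute)
  have out: "indicator B y * f y = f y" for y
  proof (cases "y \<in> B")
    case False
    then have "y \<notin> cball x r" using r(2) by blast
    then show ?thesis by (simp add: f_def)
  qed simp
  have fi: "integrable lborel f"
    using set_integrable_compact[OF B fc] by (simp add: set_integrable_def out)
  have If: "(LINT y:B|lborel. f y) = (\<integral>y. f y \<partial>lborel)"
    by (simp add: set_lebesgue_integral_def out)
  have "r / 2 * measure lborel (ball x (r / 2)) \<le> (LINT y:B|lborel. f y)"
    by (rule set_integral_ge_ball[OF fc f0 B]) (use r in \<open>auto simp: f_def subset_iff\<close>)
  moreover have "0 < r / 2 * measure lborel (ball x (r / 2))"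
    using r(1) by (intro mult_pos_pos measure_lborel_ball_pos) auto
  ultimately have pos: "(LINT y:B|lborel. f y) / 2 < (LINT y:B|lborel. f y)" by simp
  show ?thesis
    using order_tendstoD(1)[OF lim[OF fc] pos]
  proof eventually_elim
    case (elim i)
    show ?case
    proof (rule ccontr)
      assume "x \<notin> K i"
      with symmetric_integral_le_half[OF fi f0 sym compact_imp_closed[OF K(1)] K(2), of i]
      show False using elim If by simp
    qed
  qed
qed

lemma ex_finite_hull_neighbourhood:
  fixes x :: "'a::euclidean_space"
  assumes "open U" "x \<in> U"
  shows "\<exists>S. finite S \<and> S \<subseteq> U \<and> x \<in> interior (convex hull S)"
proof -
  obtain e where e: "e > 0" "cball x e \<subseteq> U" using assms open_contains_cball by blast
  define d where "d = e / DIM('a)"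
  have d: "d > 0" using e by (simp add: d_def)
  define v where "v = (\<Sum>i\<in>Basis. d *\<^sub>R i :: 'a)"
  have vb: "v \<bullet> b = d" if "b \<in> Basis" for b using that by (simp add: v_def)
  obtain S where S: "finite S" "cbox (x - v) (x + v) = convex hull S"
    using cube_convex_hull[OF d, of x] unfolding v_def by blast
  have "cbox (x - v) (x + v) \<subseteq> cball x e"
  proof
    fix y assume y: "y \<in> cbox (x - v) (x + v)"
    have "norm (y - x) \<le> (\<Sum>b\<in>Basis. \<bar>(y - x) \<bullet> b\<bar>)" by (rule norm_le_l1)
    also have "\<dots> \<le> (\<Sum>b\<in>(Basis::'a set). d)"
    proof (rule sum_mono)
      fix b :: 'a assume b: "b \<in> Basis"
      then have "(x - v) \<bullet> b \<le> y \<bullet> b" "y \<bullet> b \<le> (x + v) \<bullet> b" using y by (auto simp: mem_box)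
      then show "\<bar>(y - x) \<bullet> b\<bar> \<le> d" using vb[OF b] by (simp add: inner_diff_left inner_add_left abs_le_iff)
    qed
    also have "\<dots> = e" by (simp add: d_def)
    finally show "y \<in> cball x e" by (simp add: dist_norm norm_minus_commute)
  qed
  then have "S \<subseteq> U" using S(2) e(2) hull_subset[of S convex] by blast
  moreover have "x \<in> interior (convex hull S)"
    unfolding S(2)[symmetric] interior_cbox using d vb by (simp add: mem_box inner_diff_left inner_add_left)
  ultimately show ?thesis using S(1) by blast
qed

text \<open>A compact subset of the interior is covered by finitely many convex hulls of finite sets of
  interior points, and a convex set contains such a hull as soon as it contains the finite set.
  This upgrades the pointwise statement to a uniform one.\<close>

lemma eventually_compact_subset_of_integrals_tendsto:
  fixes K :: "'i \<Rightarrow> 'a::euclidean_space set"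
  assumes K: "\<And>i. compact (K i)" "\<And>i. convex (K i)" and B: "compact B"
    and lim: "\<And>f. continuous_on UNIV f \<Longrightarrow>
      ((\<lambda>i. LINT y:K i|lborel. f y) \<longlongrightarrow> (LINT y:B|lborel. f y :: real)) F"
    and Z: "compact Z" "Z \<subseteq> interior B"
  shows "eventually (\<lambda>i. Z \<subseteq> K i) F"
proof -
  have "\<forall>z\<in>Z. \<exists>S. finite S \<and> S \<subseteq> interior B \<and> z \<in> interior (convex hull S)"
    using Z(2) by (intro ballI ex_finite_hull_neighbourhood) auto
  then obtain S where S: "\<And>z. z \<in> Z \<Longrightarrow> finite (S z) \<and> S z \<subseteq> interior B \<and> z \<in> interior (convex hull S z)"
    by metis
  obtain Y where Y: "Y \<subseteq> Z" "finite Y" "Z \<subseteq> (\<Union>z\<in>Y. interior (convex hull S z))"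
    by (rule compactE_image[OF Z(1), of Z "\<lambda>z. interior (convex hull S z)"]) (use S in auto)
  have "eventually (\<lambda>i. \<forall>z\<in>Y. \<forall>x\<in>S z. x \<in> K i) F"
    using Y(1,2) S by (intro eventually_ball_finite ballI eventually_mem_of_integrals_tendsto[OF K B lim]) blast+
  then show ?thesis
  proof eventually_elim
    case (elim i)
    then have "convex hull S z \<subseteq> K i" if "z \<in> Y" for z
      using that by (intro hull_minimal K) auto
    then show ?case using Y(3) interior_subset by blast
  qed
qed

text \<open>If a convex body contains a fixed ball and also a point far from \<open>B\<close>, then it contains the cone
  over that ball. Near its apex the cone includes a ball whose radius is controlled from below and
  whose points are all at distance at least \<open>e / 2\<close> from \<open>B\<close>.\<close>

lemma integral_infdist_ge_of_escape:
  fixes A B :: "'a::euclidean_space set"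
  assumes A: "compact A" "convex A" and r: "0 < r" "cball p r \<subseteq> A" and p: "p \<in> B"
    and BR: "B \<subseteq> cball p R" "closed B"
    and e: "0 < e" and x: "x \<in> A" "e \<le> infdist x B"
  defines "s \<equiv> e / (2 * (e + R + r))"
  shows "e / 2 * measure lborel (ball (0::'a) (s * r)) \<le> (LINT y:A|lborel. infdist y B)"
proof -
  have R: "0 \<le> R" using p BR(1) by force
  \<comment> \<open>A ball of radius \<open>s * r\<close> sits in the cone at distance at most \<open>s * (e + R)\<close> from the apex;
    the choice of \<open>s\<close> makes these two lengths add up to \<open>e / 2\<close>.\<close>
  have s: "0 < s" "s < 1" "s * (e + R + r) = e / 2"
    using e r R by (auto simp: s_def field_simps)
  \<comment> \<open>On the way from \<open>p\<close> to \<open>x\<close> the distance from \<open>B\<close> takes the exact value \<open>e\<close>;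
    this keeps the apex of the cone at bounded distance.\<close>
  define q where "q u = p + u *\<^sub>R (x - p)" for u
  have "\<exists>u. 0 \<le> u \<and> u \<le> 1 \<and> infdist (q u) B = e"
    by (rule IVT') (use p x e in \<open>auto simp: q_def intro!: continuous_intros\<close>)
  then obtain u where u: "0 \<le> u" "u \<le> 1" "infdist (q u) B = e" by blast
  define x' where "x' = q u"
  have pA: "p \<in> A" using r by auto
  have "x' = (1 - u) *\<^sub>R p + u *\<^sub>R x" by (simp add: x'_def q_def algebra_simps)
  then have x'A: "x' \<in> A" using A(2) pA x(1) u by (simp add: convexD_alt)
  have B0: "B \<noteq> {}" using p by auto
  obtain b where b: "b \<in> B" "infdist x' B = dist x' b" using infdist_attains_inf[OF BR(2) B0] by blast
  have "dist x' p \<le> dist x' b + dist b p" by (rule dist_triangle)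
  also have "\<dots> \<le> e + R" using b u(3) BR(1) by (auto simp: x'_def dist_commute subset_iff)
  finally have x'p: "dist x' p \<le> e + R" .
  define z where "z = (1 - s) *\<^sub>R x' + s *\<^sub>R p"
  have ball: "y \<in> A \<and> e / 2 \<le> infdist y B" if y: "y \<in> ball z (s * r)" for y
  proof
    define w where "w = p + (1 / s) *\<^sub>R (y - z)"
    have "norm ((1 / s) *\<^sub>R (y - z)) < r"
    proof -
      have "norm (y - z) < s * r" using y by (simp add: dist_norm norm_minus_commute)
      then have "norm (y - z) / s < r" using s by (simp add: pos_divide_less_eq mult.commute)
      then show ?thesis using s by simp
    qed
    then have "w \<in> cball p r" by (simp add: w_def dist_norm)
    then have "w \<in> A" using r by blast
    moreover have "y = (1 - s) *\<^sub>R x' + s *\<^sub>R w" using s by (simp add: w_def z_def algebra_simps)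
    ultimately show "y \<in> A" using A(2) x'A s by (simp add: convexD_alt)
    have "dist x' z = s * dist x' p"
    proof -
      have "x' - z = s *\<^sub>R (x' - p)" by (simp add: z_def algebra_simps)
      then show ?thesis using s by (simp add: dist_norm)
    qed
    also have "\<dots> \<le> s * (e + R)" using x'p s by (intro mult_left_mono) auto
    finally have "dist x' y \<le> s * (e + R) + s * r"
      using y dist_triangle[of x' y z] by simp
    also have "\<dots> = e / 2" using s(3) by (simp add: algebra_simps)
    finally have "dist x' y \<le> e / 2" .
    moreover have "infdist x' B \<le> infdist y B + dist x' y" by (rule infdist_triangle)
    ultimately show "e / 2 \<le> infdist y B" using u(3) by (simp add: x'_def)
  qed
  have "e / 2 * measure lborel (ball z (s * r)) \<le> (LINT y:A|lborel. infdist y B)"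
    by (rule set_integral_ge_ball) (use ball A in \<open>auto intro!: continuous_intros infdist_nonneg\<close>)
  then show ?thesis using measure_lborel_ball_translate[of "s * r" z 0] s r by simp
qed

text \<open>The test function is the distance from \<open>B\<close>, whose integral over \<open>B\<close> is 0. The integral
  over a body that reaches far out has a positive lower bound: no body in the family can have a
  spike so thin that the integral misses it, because the bodies share a ball.\<close>

lemma eventually_infdist_less_of_integrals_tendsto:
  fixes K :: "'i \<Rightarrow> 'a::euclidean_space set"
  assumes K: "\<And>i. compact (K i)" "\<And>i. convex (K i)" and B: "compact B" "interior B \<noteq> {}"
    and lim: "\<And>f. continuous_on UNIV f \<Longrightarrow>
      ((\<lambda>i. LINT y:K i|lborel. f y) \<longlongrightarrow> (LINT y:B|lborel. f y :: real)) F"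
    and e: "0 < e"
  shows "eventually (\<lambda>i. \<forall>x\<in>K i. infdist x B < e) F"
proof -
  obtain p where "p \<in> interior B" using B(2) by blast
  then obtain r where r: "r > 0" "cball p r \<subseteq> interior B"
    using open_contains_cball open_interior by blast
  have pB: "p \<in> B" using \<open>p \<in> interior B\<close> interior_subset by blast
  obtain R where R: "B \<subseteq> cball p R"
  proof -
    obtain R where "B \<subseteq> ball p R"
      using bounded_subset_ballD[OF compact_imp_bounded[OF B(1)], of p] by auto
    then show ?thesis using that ball_subset_cball by blast
  qed
  have R0: "0 \<le> R" using R pB by force
  define s where "s = e / (2 * (e + R + r))"
  have s: "0 < s" using e R0 r by (simp add: s_def)
  define c where "c = e / 2 * measure lborel (ball (0::'a) (s * r))"
  have c: "0 < c" unfolding c_def using e s r by (intro mult_pos_pos measure_lborel_ball_pos) auto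
  have "(LINT y:B|lborel. infdist y B) = 0"
    unfolding set_lebesgue_integral_def by (intro integral_eq_zero_AE AE_I2) (auto simp: indicator_def)
  then have "eventually (\<lambda>i. (LINT y:K i|lborel. infdist y B) < c) F"
    using order_tendstoD(2)[OF lim, of "\<lambda>y. infdist y B" c] c by (simp add: continuous_intros)
  moreover have "eventually (\<lambda>i. cball p r \<subseteq> K i) F"
    by (rule eventually_compact_subset_of_integrals_tendsto[OF K B(1) lim compact_cball r(2)])
  ultimately show ?thesis
  proof eventually_elim
    case (elim i)
    show ?case
    proof (intro ballI, rule ccontr)
      fix x assume x: "x \<in> K i" "\<not> infdist x B < e"
      have "c \<le> (LINT y:K i|lborel. infdist y B)"
        unfolding c_def s_def
        by (rule integral_infdist_ge_of_escape[OF K r(1) elim(2) pB R compact_imp_closed[OF B(1)] e x(1)])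
           (use x(2) in simp)
      then show False using elim(1) by simp
    qed
  qed
qed

lemma infdist_frontier_le:
  fixes B :: "'a::euclidean_space set"
  assumes "closed B" "B \<noteq> {}" "x \<notin> B"
  shows "infdist x (frontier B) \<le> infdist x B"
proof -
  obtain b where b: "b \<in> B" "infdist x B = dist x b"
    using infdist_attains_inf[OF assms(1,2)] by blast
  have "closed_segment x b \<inter> frontier B \<noteq> {}"
    by (rule connected_Int_frontier) (use b assms in auto)
  then obtain w where w: "w \<in> closed_segment x b" "w \<in> frontier B" by blast
  have "infdist x (frontier B) \<le> dist x w" by (rule infdist_le[OF w(2)])
  also have "\<dots> \<le> dist x b" using segment_bound(1)[OF w(1)] by (simp add: dist_norm norm_minus_commute)
  finally show ?thesis using b by simp
qed

text \<open>Points that \<open>K i\<close> gains are close to \<open>B\<close>, hence to its frontier; points that it loses lie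
  outside the compact part of \<open>B\<close> at distance at least \<open>e\<close> from the frontier.\<close>

lemma eventually_symm_diff_near_frontier:
  fixes K :: "'i \<Rightarrow> 'a::euclidean_space set"
  assumes K: "\<And>i. compact (K i)" "\<And>i. convex (K i)" and B: "compact B" "interior B \<noteq> {}"
    and lim: "\<And>f. continuous_on UNIV f \<Longrightarrow>
      ((\<lambda>i. LINT y:K i|lborel. f y) \<longlongrightarrow> (LINT y:B|lborel. f y :: real)) F"
    and e: "0 < e"
  shows "eventually (\<lambda>i. \<forall>x \<in> (K i - B) \<union> (B - K i). infdist x (frontier B) < e) F"
proof -
  define Z where "Z = B \<inter> {x. e \<le> infdist x (frontier B)}"
  have "closed {x. e \<le> infdist x (frontier B)}"
    by (intro closed_Collect_le continuous_intros)
  then have "compact Z" unfolding Z_def using B by (intro compact_Int_closed)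
  moreover have "Z \<subseteq> interior B"
  proof
    fix x assume x: "x \<in> Z"
    then have "x \<notin> frontier B" using e by (auto simp: Z_def)
    then show "x \<in> interior B" using x closure_subset by (auto simp: Z_def frontier_def)
  qed
  ultimately have "eventually (\<lambda>i. Z \<subseteq> K i) F"
    by (intro eventually_compact_subset_of_integrals_tendsto[OF K B(1) lim])
  moreover have "eventually (\<lambda>i. \<forall>x\<in>K i. infdist x B < e) F"
    by (rule eventually_infdist_less_of_integrals_tendsto[OF K B lim e])
  ultimately show ?thesis
  proof eventually_elim
    case (elim i)
    have "infdist x (frontier B) < e" if "x \<in> K i" "x \<notin> B" for x
    proof -
      have "B \<noteq> {}" using B(2) by auto
      then have "infdist x (frontier B) \<le> infdist x B"
        using that(2) by (intro infdist_frontier_le compact_imp_closed B)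
      also have "\<dots> < e" using elim(2) that(1) by blast
      finally show ?thesis .
    qed
    then show ?case using elim(1) by (force simp: Z_def)
  qed
qed

section \<open>The derivative as a signed measure on the boundary\<close>

text \<open>Open sets \<open>V\<close> disjoint from \<open>X\<close> are exhausted by continuous functions that vanish near the
  complement of \<open>V\<close>, hence near \<open>X\<close>; open sets form an intersection-stable generator of the Borel
  sets. Testing only with functions that vanish on a neighbourhood of \<open>X\<close>, not just on \<open>X\<close>, matches
  what is known about the limit functional.\<close>

lemma finite_borel_measures_eq_off:
  fixes P Q :: "'a::euclidean_space measure"
  assumes S: "sets P = sets borel" "sets Q = sets borel"
    and fin: "finite_measure P" "finite_measure Q"
    and X: "compact X" "X \<noteq> {}"
    and eq: "\<And>f e. continuous_on UNIV f \<Longrightarrow> (\<And>x. \<bar>f x\<bar> \<le> 1) \<Longrightarrow> 0 < e \<Longrightarrow>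
       (\<And>x. infdist x X < e \<Longrightarrow> f x = 0) \<Longrightarrow> integral\<^sup>L P f = (integral\<^sup>L Q f :: real)"
    and A: "A \<in> sets borel" "A \<subseteq> - X"
  shows "measure P A = measure Q A"
proof -
  interpret P: finite_measure P by fact
  interpret Q: finite_measure Q by fact
  note [measurable_cong] = S
  have open_eq: "measure P V = measure Q V" if V: "open V" "V \<inter> X = {}" for V
  proof -
    have V': "closed (- V)" "- V \<noteq> {}" "X \<subseteq> - V" using V X by auto
    define f where "f m x = min 1 (max 0 (real m * infdist x (- V) - 1))" for m and x :: 'a
    have f1: "\<bar>f m x\<bar> \<le> 1" for m x by (simp add: f_def)
    have fc: "continuous_on UNIV (f m)" for m unfolding f_def by (intro continuous_intros)
    have [measurable]: "f m \<in> borel_measurable borel" for m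
      by (rule borel_measurable_continuous_onI[OF fc])
    have [measurable]: "V \<in> sets borel" using V by simp
    have lim: "(\<lambda>m. f m x) \<longlonglongrightarrow> indicator V x" for x
    proof (cases "x \<in> V")
      case False
      then have "f m x = 0" for m by (simp add: f_def)
      then show ?thesis using False by simp
    next
      case True
      then have pos: "infdist x (- V) > 0"
        using V' by (metis ComplD in_closed_iff_infdist_zero infdist_nonneg less_eq_real_def)
      then obtain N :: nat where N: "2 < real N * infdist x (- V)" using reals_Archimedean3 by blast
      have "eventually (\<lambda>m. f m x = indicator V x) sequentially"
        using eventually_ge_at_top[of N]
      proof eventually_elim
        case (elim m)
        then have "real N * infdist x (- V) \<le> real m * infdist x (- V)" using pos by simp
        with N True show ?case by (simp add: f_def)
      qed
      then show ?thesis by (rule tendsto_eventually)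
    qed
    have "integral\<^sup>L P (f m) = integral\<^sup>L Q (f m)" for m
    proof (rule eq[OF fc f1])
      show "0 < 1 / real (Suc m)" by simp
      show "f m x = 0" if "infdist x X < 1 / real (Suc m)" for x
      proof -
        have "infdist x (- V) \<le> infdist x X" by (rule infdist_mono[OF V'(3) X(2)])
        then have "infdist x (- V) \<le> 1 / real (Suc m)" using that by simp
        then have "real m * infdist x (- V) \<le> real m * (1 / real (Suc m))" by (intro mult_left_mono) auto
        also have "\<dots> \<le> 1" by simp
        finally show ?thesis by (simp add: f_def)
      qed
    qed
    moreover have "(\<lambda>m. integral\<^sup>L N (f m)) \<longlonglongrightarrow> measure N V"
      if N: "sets N = sets borel" "finite_measure N" for N
    proof -
      interpret N: finite_measure N by fact
      note [measurable_cong] = N(1)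
      have "(\<lambda>m. integral\<^sup>L N (f m)) \<longlonglongrightarrow> integral\<^sup>L N (indicator V :: 'a \<Rightarrow> real)"
        by (rule integral_dominated_convergence[where w = "\<lambda>_. 1"])
           (auto simp: f1 lim)
      then show ?thesis using sets_eq_imp_space_eq[OF N(1)] by simp
    qed
    ultimately show ?thesis
      using LIMSEQ_unique S fin by (metis (no_types, lifting) ext)
  qed
  have [measurable]: "X \<in> sets borel" using X by (simp add: compact_imp_closed)
  define R where "R N = density N (indicator (- X))" for N :: "'a measure"
  have R: "emeasure (R N) B = emeasure N (B - X)" if "sets N = sets borel" "B \<in> sets borel" for N B
  proof -
    note [measurable_cong] = that(1)
    have "emeasure (R N) B = (\<integral>\<^sup>+x. indicator (- X) x * indicator B x \<partial>N)"
      unfolding R_def using that by (subst emeasure_density) auto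
    also have "\<dots> = (\<integral>\<^sup>+x. indicator (B - X) x \<partial>N)"
      by (intro nn_integral_cong) (auto simp: indicator_def)
    also have "\<dots> = emeasure N (B - X)" using that by simp
    finally show ?thesis .
  qed
  have "R P = R Q"
  proof (rule measure_eqI_generator_eq[where E = "{V. open V}" and \<Omega> = UNIV and A = "\<lambda>_. UNIV"])
    show "Int_stable {V :: 'a set. open V}" by (auto simp: Int_stable_def)
    show "sets (R P) = sigma_sets UNIV {V. open V}" "sets (R Q) = sigma_sets UNIV {V. open V}"
      using S by (simp_all add: R_def borel_def)
    show "emeasure (R P) V = emeasure (R Q) V" if "V \<in> {V. open V}" for V
    proof -
      have "open (V - X)" using that X compact_imp_closed by auto
      then have "measure P (V - X) = measure Q (V - X)" by (intro open_eq) auto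
      then show ?thesis using that S
        by (simp add: R P.emeasure_eq_measure Q.emeasure_eq_measure)
    qed
    show "emeasure (R P) UNIV \<noteq> \<infinity>" for i :: nat
      using S by (simp add: R P.emeasure_eq_measure)
  qed auto
  then have "emeasure P (A - X) = emeasure Q (A - X)" using R S A(1) by metis
  moreover have "A - X = A" using A(2) by auto
  ultimately show ?thesis by (simp add: measure_def)
qed

lemma set_integral_diff_eq_symm_diff:
  fixes f :: "'a \<Rightarrow> real"
  assumes f: "set_integrable M A f" "set_integrable M B f" and AB: "A \<in> sets M" "B \<in> sets M"
  shows "(LINT x:A|M. f x) - (LINT x:B|M. f x) = (LINT x:A - B|M. f x) - (LINT x:B - A|M. f x)"
proof -
  have split: "(LINT x:S|M. f x) = (LINT x:S - T|M. f x) + (LINT x:S \<inter> T|M. f x)"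
    if "set_integrable M S f" "S \<in> sets M" "T \<in> sets M" for S T
  proof -
    have "set_integrable M (S - T) f" "set_integrable M (S \<inter> T) f"
      using that by (auto intro: set_integrable_subset)
    moreover have "(S - T) \<union> (S \<inter> T) = S" "(S - T) \<inter> (S \<inter> T) = {}" by auto
    ultimately show ?thesis using set_integral_Un[of "S - T" "S \<inter> T" M f] by simp
  qed
  show ?thesis using split[OF f(1) AB] split[OF f(2) AB(2,1)] by (simp add: Int_commute)
qed

text \<open>The quotient is integration against \<open>c k\<close> times Lebesgue measure on \<open>K k - B\<close>, minus \<open>c k\<close> times
  Lebesgue measure on \<open>B - K k\<close>. Both parts have bounded mass and live on a common bounded set, so
  along one subsequence they converge vaguely to \<open>P\<close> and \<open>Q\<close>. Since the whole sequence converges,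
  \<open>P - Q\<close> represents \<open>L\<close>. It is carried by the boundary of \<open>B\<close> because \<open>L\<close> vanishes on functions
  that vanish near it.\<close>

lemma ex_signed_measure_of_difference_quotients:
  fixes K :: "nat \<Rightarrow> 'a::euclidean_space set" and B :: "'a set" and c :: "nat \<Rightarrow> real"
  assumes K: "\<And>k. compact (K k)" "\<And>k. convex (K k)" "\<And>k. K k \<noteq> {}"
    and B: "compact B" "interior B \<noteq> {}"
    and c: "filterlim c at_top sequentially" "\<And>k. 0 \<le> c k"
    and L: "\<And>f. continuous_on UNIV f \<Longrightarrow>
      (\<lambda>k. c k * ((LINT x:K k|lborel. f x) - (LINT x:B|lborel. f x))) \<longlonglongrightarrow> L f"
  shows "\<exists>\<mu> \<in> signed_measures_on (frontier B).
     \<forall>f. continuous_on UNIV f \<longrightarrow> L f = signed_set_integral \<mu> (frontier B) f"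
proof -
  have Bne: "B \<noteq> {}" using B(2) interior_subset by fastforce
  have [measurable]: "K k \<in> sets borel" "B \<in> sets borel" for k
    using K B by (auto simp: compact_imp_closed)
  have int_lim: "(\<lambda>k. LINT x:K k|lborel. f x) \<longlonglongrightarrow> (LINT x:B|lborel. f x)"
    if f: "continuous_on UNIV f" for f :: "'a \<Rightarrow> real"
  proof -
    have "(\<lambda>k. inverse (c k) * (c k * ((LINT x:K k|lborel. f x) - (LINT x:B|lborel. f x)))) \<longlonglongrightarrow> 0 * L f"
      by (intro tendsto_mult L f tendsto_inverse_0_at_top c)
    moreover have "eventually (\<lambda>k. inverse (c k) * (c k * ((LINT x:K k|lborel. f x) - (LINT x:B|lborel. f x)))
        = (LINT x:K k|lborel. f x) - (LINT x:B|lborel. f x)) sequentially"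
      using c(1)[unfolded filterlim_at_top_dense, rule_format, of 0]
      by eventually_elim simp
    ultimately have "(\<lambda>k. (LINT x:K k|lborel. f x) - (LINT x:B|lborel. f x)) \<longlonglongrightarrow> 0"
      by (simp add: tendsto_cong)
    then show ?thesis by (simp add: LIM_zero_iff)
  qed
  define X where "X = frontier B"
  have "B \<noteq> UNIV" using compact_imp_bounded[OF B(1)] not_bounded_UNIV by auto
  then have X: "compact X" "X \<noteq> {}"
    unfolding X_def using compact_frontier[OF B(1)] Bne by (simp_all add: frontier_eq_empty)
  define D where "D = {x. infdist x B \<le> 1}"
  have D: "bounded D"
  proof -
    obtain r where r: "B \<subseteq> ball 0 r" using bounded_subset_ballD[OF compact_imp_bounded[OF B(1)], of 0] by auto
    have "norm x \<le> r + 1" if "x \<in> D" for x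
    proof -
      obtain b where b: "b \<in> B" "infdist x B = dist x b"
        using infdist_attains_inf[OF compact_imp_closed[OF B(1)] Bne] by blast
      then have "norm b < r" "dist x b \<le> 1" using r that by (auto simp: D_def)
      then show ?thesis using norm_triangle_ineq2[of x b] by (simp add: dist_norm)
    qed
    then show ?thesis by (rule boundedI)
  qed
  have "eventually (\<lambda>k. \<forall>x\<in>K k. infdist x B < 1) sequentially"
    by (rule eventually_infdist_less_of_integrals_tendsto[OF K(1,2) B int_lim]) auto
  then obtain N where N: "\<And>k. N \<le> k \<Longrightarrow> K k \<subseteq> D"
    unfolding eventually_sequentially D_def by (fastforce intro: less_imp_le)
  have BD: "B \<subseteq> D" by (auto simp: D_def)
  \<comment> \<open>Dropping the first \<open>N\<close> bodies leaves all others in the bounded set \<open>D\<close>.\<close>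
  define H where "H k = K (k + N)" for k
  define a where "a k = c (k + N)" for k
  have H: "compact (H k)" "H k \<noteq> {}" "H k \<subseteq> D" for k using K N by (auto simp: H_def)
  have [measurable]: "H k \<in> sets borel" for k by (simp add: H_def)
  have a0: "0 \<le> a k" for k by (simp add: a_def c)
  have La: "(\<lambda>k. a k * ((LINT x:H k|lborel. f x) - (LINT x:B|lborel. f x))) \<longlonglongrightarrow> L f"
    if "continuous_on UNIV f" for f
    using LIMSEQ_ignore_initial_segment[OF L[OF that], of N] by (simp add: a_def H_def)
  obtain V where V: "\<And>k. \<bar>a k\<bar> * (measure lborel (H k - B) + measure lborel (B - H k)) \<le> V"
  proof -
    have "bounded (range (\<lambda>k. a k * ((LINT x:H k|lborel. f x) - (LINT x:B|lborel. f x))))"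
      if "continuous_on UNIV f" for f
      by (rule convergent_imp_bounded[OF La[OF that]])
    from volume_symm_diff_quotient_bounded[OF H(1,2) B(1) Bne this] that show ?thesis by auto
  qed
  \<comment> \<open>The difference quotient at \<open>f\<close> is the integral of \<open>f\<close> against \<open>M (a k) (H k) B\<close> minus the one
    against \<open>M (a k) B (H k)\<close>.\<close>
  define M where "M r S T = density lborel (\<lambda>x. ennreal (r * indicator (S - T) x))"
    for r and S T :: "'a set"
  have sets_M [simp]: "sets (M r S T) = sets borel" for r S T by (simp add: M_def)
  have M: "finite_measure (M r S T) \<and> measure (M r S T) UNIV = r * measure lborel (S - T) \<and>
      (AE x in M r S T. x \<in> D) \<and>
      (\<forall>f :: 'a \<Rightarrow> real. continuous_on UNIV f \<longrightarrow>
        integral\<^sup>L (M r S T) f = r * (LINT x:S - T|lborel. f x))"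
    if r: "0 \<le> r" and S: "compact S" "compact T" "S \<subseteq> D" for r S T
  proof -
    have [measurable]: "S \<in> sets borel" "T \<in> sets borel" using S by (auto simp: compact_imp_closed)
    have fin: "emeasure lborel (S - T) < \<infinity>"
      using emeasure_mono[of "S - T" S lborel] emeasure_compact_finite[OF S(1)] by auto
    have "emeasure (M r S T) UNIV = (\<integral>\<^sup>+x. ennreal r * indicator (S - T) x \<partial>lborel)"
      unfolding M_def by (subst emeasure_density) (auto intro!: nn_integral_cong simp: indicator_def)
    also have "\<dots> = ennreal r * emeasure lborel (S - T)"
      by (subst nn_integral_cmult) auto
    also have "\<dots> = ennreal (r * measure lborel (S - T))"
      using fin r by (simp add: emeasure_eq_ennreal_measure ennreal_mult)
    finally have em: "emeasure (M r S T) UNIV = ennreal (r * measure lborel (S - T))" .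
    have sp: "space (M r S T) = UNIV" by (simp add: M_def)
    have "finite_measure (M r S T)" by (rule finite_measureI) (simp add: sp em)
    moreover have "measure (M r S T) UNIV = r * measure lborel (S - T)"
      using em r by (simp add: measure_def)
    moreover have "AE x in M r S T. x \<in> D"
      unfolding M_def using S(3) by (subst AE_density) (auto simp: indicator_def)
    moreover have "integral\<^sup>L (M r S T) f = r * (LINT x:S - T|lborel. f x)"
      if f: "continuous_on UNIV f" for f :: "'a \<Rightarrow> real"
    proof -
      have [measurable]: "f \<in> borel_measurable borel" by (rule borel_measurable_continuous_onI[OF f])
      have "integral\<^sup>L (M r S T) f = (\<integral>x. (r * indicator (S - T) x) *\<^sub>R f x \<partial>lborel)"
        unfolding M_def using r by (subst integral_density) auto
      then show ?thesis by (simp add: set_lebesgue_integral_def mult.assoc)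
    qed
    ultimately show ?thesis by blast
  qed
  have M1: "0 \<le> a k" "compact (H k)" "compact B" "H k \<subseteq> D" and M2: "0 \<le> a k" "compact B" "compact (H k)" "B \<subseteq> D" for k
    using a0 H B BD by auto
  have mass: "a k * measure lborel (H k - B) \<le> V" "a k * measure lborel (B - H k) \<le> V" for k
  proof -
    have "a k * measure lborel (H k - B) + a k * measure lborel (B - H k) \<le> V"
      using V[of k] a0[of k] by (simp add: distrib_left)
    moreover have "0 \<le> a k * measure lborel (H k - B)" "0 \<le> a k * measure lborel (B - H k)"
      by (simp_all add: a0)
    ultimately show "a k * measure lborel (H k - B) \<le> V" "a k * measure lborel (B - H k) \<le> V"
      by linarith+
  qed
  obtain r1 P D1 where P: "strict_mono (r1 :: nat \<Rightarrow> nat)" "finite_measure P" "sets P = sets borel"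
    "compact D1" "AE x in P. x \<in> D1"
    "\<And>f :: 'a \<Rightarrow> real. continuous_on UNIV f \<Longrightarrow>
       (\<lambda>k. integral\<^sup>L (M (a (r1 k)) (H (r1 k)) B) f) \<longlonglongrightarrow> integral\<^sup>L P f"
    using vague_sequential_compactness[of "\<lambda>k. M (a k) (H k) B" V D] M[OF M1] mass D by auto
  obtain r2 Q D2 where Q: "strict_mono (r2 :: nat \<Rightarrow> nat)" "finite_measure Q" "sets Q = sets borel"
    "compact D2" "AE x in Q. x \<in> D2"
    "\<And>f :: 'a \<Rightarrow> real. continuous_on UNIV f \<Longrightarrow>
       (\<lambda>k. integral\<^sup>L (M (a (r1 (r2 k))) B (H (r1 (r2 k)))) f) \<longlonglongrightarrow> integral\<^sup>L Q f"
    using vague_sequential_compactness[of "\<lambda>k. M (a (r1 k)) B (H (r1 k))" V D] M[OF M2] mass D by auto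
  have L_eq: "L f = integral\<^sup>L P f - integral\<^sup>L Q f" if f: "continuous_on UNIV f" for f
  proof -
    have "(\<lambda>k. integral\<^sup>L (M (a (r1 (r2 k))) (H (r1 (r2 k))) B) f
        - integral\<^sup>L (M (a (r1 (r2 k))) B (H (r1 (r2 k)))) f) \<longlonglongrightarrow> integral\<^sup>L P f - integral\<^sup>L Q f"
      using LIMSEQ_subseq_LIMSEQ[OF P(6)[OF f] Q(1)] Q(6)[OF f] by (intro tendsto_diff) (auto simp: o_def)
    moreover have "integral\<^sup>L (M (a k) (H k) B) f - integral\<^sup>L (M (a k) B (H k)) f
        = a k * ((LINT x:H k|lborel. f x) - (LINT x:B|lborel. f x))" for k
    proof -
      have i: "set_integrable lborel (H k) f" "set_integrable lborel B f"
        by (simp_all add: set_integrable_compact f H B)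
      have "(LINT x:H k|lborel. f x) - (LINT x:B|lborel. f x)
          = (LINT x:H k - B|lborel. f x) - (LINT x:B - H k|lborel. f x)"
        by (rule set_integral_diff_eq_symm_diff[OF i]) simp_all
      then show ?thesis using M[OF M1] M[OF M2] f by (simp flip: right_diff_distrib)
    qed
    ultimately have "(\<lambda>k. a (r1 (r2 k)) * ((LINT x:H (r1 (r2 k))|lborel. f x) - (LINT x:B|lborel. f x)))
        \<longlonglongrightarrow> integral\<^sup>L P f - integral\<^sup>L Q f" by simp
    moreover have "(\<lambda>k. a (r1 (r2 k)) * ((LINT x:H (r1 (r2 k))|lborel. f x) - (LINT x:B|lborel. f x))) \<longlonglongrightarrow> L f"
      using LIMSEQ_subseq_LIMSEQ[OF La[OF f] strict_mono_o[OF P(1) Q(1)]] by (simp add: o_def)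
    ultimately show ?thesis using LIMSEQ_unique by blast
  qed
  have vanish: "L f = 0" if f: "continuous_on UNIV f" and e: "0 < e" "\<And>x. infdist x X < e \<Longrightarrow> f x = 0" for f e
  proof -
    have "eventually (\<lambda>k. \<forall>x \<in> (K k - B) \<union> (B - K k). infdist x (frontier B) < e) sequentially"
      by (rule eventually_symm_diff_near_frontier[OF K(1,2) B int_lim e(1)])
    then have "eventually (\<lambda>k. c k * ((LINT x:K k|lborel. f x) - (LINT x:B|lborel. f x)) = 0) sequentially"
    proof eventually_elim
      case (elim k)
      then have same: "indicator (K k) x *\<^sub>R f x = indicator B x *\<^sub>R f x" for x
        using e(2)[of x] unfolding X_def by (cases "x \<in> K k"; cases "x \<in> B") auto
      have "(LINT x:K k|lborel. f x) = (LINT x:B|lborel. f x)"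
        by (simp only: set_lebesgue_integral_def same)
      then show ?case by simp
    qed
    from LIMSEQ_unique[OF L[OF f] tendsto_eventually[OF this]] show ?thesis .
  qed
  have off: "measure P A = measure Q A" if "A \<in> sets borel" "A \<subseteq> - X" for A
    by (rule finite_borel_measures_eq_off[OF P(3) Q(3) P(2) Q(2) X _ that])
       (use vanish L_eq in fastforce)
  have integrable: "integrable N f"
    if f: "continuous_on UNIV f" and N: "finite_measure N" "sets N = sets borel" "compact E" "AE x in N. x \<in> E"
    for N E and f :: "'a \<Rightarrow> real"
  proof -
    interpret finite_measure N by fact
    note [measurable_cong] = N(2)
    have [measurable]: "f \<in> borel_measurable borel" by (rule borel_measurable_continuous_onI[OF f])
    obtain A where A: "\<And>x. x \<in> E \<Longrightarrow> norm (f x) \<le> A"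
      using compact_continuous_image[OF continuous_on_subset[OF f] N(3)] compact_imp_bounded bounded_iff
      by (metis image_eqI subset_UNIV)
    have "AE x in N. norm (f x) \<le> A" using N(4) by eventually_elim (rule A)
    then show ?thesis by (rule integrable_const_bound) measurable
  qed
  define \<mu> where "\<mu> A = measure P A - measure Q A" for A
  have "\<mu> \<in> signed_measures_on X"
    unfolding signed_measures_on_def \<mu>_def[abs_def]
    using signed_borel_measure_diff[OF P(3) Q(3) P(2) Q(2)] off by auto
  moreover have "L f = signed_set_integral \<mu> X f" if f: "continuous_on UNIV f" for f
    unfolding \<mu>_def[abs_def] L_eq[OF f]
    by (rule signed_set_integral_diff[OF P(3) Q(3) P(2) Q(2) X(1) off f, symmetric])
       (use integrable[OF f] P Q in auto)
  ultimately show ?thesis unfolding X_def by blast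
qed

theorem proposition1p3:
  fixes K :: "real \<Rightarrow> (real ^ 'n) set"
  assumes "\<And>t. t \<in> {0..1} \<Longrightarrow> convex_body (K t) \<and> full_dimensional (K t)"
  shows "weakly_differentiable K \<longleftrightarrow>
    (\<exists>\<mu> \<in> signed_measures_on (frontier (K 0)).
      \<forall>f :: real ^ 'n \<Rightarrow> real. continuous_on UNIV f \<longrightarrow>
        (body_integral K f has_real_derivative
           signed_set_integral \<mu> (frontier (K 0)) f) (at_right 0) \<and>
        ((\<lambda>t. 1 / t * ((LINT x:K t|lborel. f x) - (LINT x:K 0|lborel. f x)))
           \<longlongrightarrow> signed_set_integral \<mu> (frontier (K 0)) f) (at_right 0))"
proof
  assume "weakly_differentiable K"
  then have "\<exists>D. (body_integral K f has_real_derivative D) (at_right 0)"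
    if "continuous_on UNIV f" for f
    using that unfolding weakly_differentiable_def real_differentiable_def by blast
  then obtain L where L: "\<And>f. continuous_on UNIV f \<Longrightarrow> (body_integral K f has_real_derivative L f) (at_right 0)"
    by metis
  have quot: "((\<lambda>t. 1 / t * ((LINT x:K t|lborel. f x) - (LINT x:K 0|lborel. f x))) \<longlongrightarrow> L f) (at_right 0)"
    if "continuous_on UNIV f" for f
    using L[OF that] by (simp add: has_field_derivative_iff body_integral_def)
  define t :: "nat \<Rightarrow> real" where "t k = 1 / real (Suc k)" for k
  have t: "0 < t k" "t k \<le> 1" for k by (auto simp: t_def)
  have t0: "filterlim t (at_right 0) sequentially"
    unfolding filterlim_at
  proof
    show "eventually (\<lambda>k. t k \<in> {0<..} \<and> t k \<noteq> 0) sequentially" using t(1) by (auto simp: less_imp_neq[symmetric])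
    show "t \<longlonglongrightarrow> 0" unfolding t_def using LIMSEQ_inverse_real_of_nat by (simp add: inverse_eq_divide)
  qed
  have body: "compact (K s)" "convex (K s)" "K s \<noteq> {}" "interior (K s) \<noteq> {}" if "s \<in> {0..1}" for s
  proof -
    show *: "compact (K s)" "convex (K s)" "K s \<noteq> {}" using assms[OF that] by (auto simp: convex_body_def)
    have "aff_dim (K s) = int DIM(real ^ 'n)" using assms[OF that] by (simp add: full_dimensional_def)
    then have "affine hull (K s) = UNIV" using aff_dim_eq_full by blast
    then have "rel_interior (K s) = interior (K s)" by (rule rel_interior_interior)
    then show "interior (K s) \<noteq> {}" using rel_interior_eq_empty[OF *(2)] *(3) by simp
  qed
  have t01: "t k \<in> {0..1}" for k using t[of k] by simp
  have ct: "1 / t k = real (Suc k)" for k by (simp add: t_def)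
  have "\<exists>\<mu> \<in> signed_measures_on (frontier (K 0)).
     \<forall>f. continuous_on UNIV f \<longrightarrow> L f = signed_set_integral \<mu> (frontier (K 0)) f"
  proof (rule ex_signed_measure_of_difference_quotients[of "\<lambda>k. K (t k)" "K 0" "\<lambda>k. 1 / t k"])
    show "filterlim (\<lambda>k. 1 / t k) at_top sequentially"
      unfolding ct using filterlim_compose[OF filterlim_real_sequentially filterlim_Suc] .
    show "(\<lambda>k. 1 / t k * ((LINT x:K (t k)|lborel. f x) - (LINT x:K 0|lborel. f x))) \<longlonglongrightarrow> L f"
      if "continuous_on UNIV f" for f
      using filterlim_compose[OF quot[OF that] t0] .
  qed (use body[OF t01] body[of 0] t in \<open>auto intro: less_imp_le\<close>)
  then obtain \<mu> where \<mu>: "\<mu> \<in> signed_measures_on (frontier (K 0))"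
    "\<And>f. continuous_on UNIV f \<Longrightarrow> signed_set_integral \<mu> (frontier (K 0)) f = L f" by force
  show "\<exists>\<mu> \<in> signed_measures_on (frontier (K 0)).
      \<forall>f :: real ^ 'n \<Rightarrow> real. continuous_on UNIV f \<longrightarrow>
        (body_integral K f has_real_derivative
           signed_set_integral \<mu> (frontier (K 0)) f) (at_right 0) \<and>
        ((\<lambda>t. 1 / t * ((LINT x:K t|lborel. f x) - (LINT x:K 0|lborel. f x)))
           \<longlongrightarrow> signed_set_integral \<mu> (frontier (K 0)) f) (at_right 0)"
    using \<mu> L quot by (intro bexI[of _ \<mu>]) auto
next
  assume "\<exists>\<mu> \<in> signed_measures_on (frontier (K 0)).
      \<forall>f :: real ^ 'n \<Rightarrow> real. continuous_on UNIV f \<longrightarrow>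
        (body_integral K f has_real_derivative
           signed_set_integral \<mu> (frontier (K 0)) f) (at_right 0) \<and>
        ((\<lambda>t. 1 / t * ((LINT x:K t|lborel. f x) - (LINT x:K 0|lborel. f x)))
           \<longlongrightarrow> signed_set_integral \<mu> (frontier (K 0)) f) (at_right 0)"
  then show "weakly_differentiable K"
    unfolding weakly_differentiable_def real_differentiable_def by blast
qed

end
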